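(* Let $G$ be a connected unicycle graph of order $n$ with $l(G)$ leaves and $s(G)$ support vertices. Then $\gamma_{o}(G)=\frac{n-l(G)+s(G)}{3}$ if and only if $G\in\mathcal{G}$, where $\mathcal{G}$ is the family of unicycle graphs defined in the context.
   Context: All graphs $G=(V,E)$ are finite and simple; the order of $G$ is $n=|V|$. A unicycle graph is a graph that contains exactly one cycle. For $v\in V$, $N(v)=\{u\in V: uv\in E\}$ is the open neighborhood and $N[v]=N(v)\cup\{v\}$ the closed neighborhood; the degree of $v$ is $|N(v)|$. A leaf is a vertex of degree one, and a support vertex is a vertex adjacent to at least one leaf. $l(G)$ and $s(G)$ denote the numbers of leaves and of support vertices of $G$, respectively. A set $S\subseteq V$ is a dominating set if every vertex of $V-S$ has at least one neighbor in $S$. A global offensive alliance of $G$ is a dominating set $S$ such that $|N[v]\cap S|\geq|N[v]-S|$ for every $v\in V-S$. The global offensive alliance number $\gamma_{o}(G)$ is the minimum cardinality of a global offensive alliance of $G$. The family $\mathcal{G}$ consists of all graphs $G$ that can be obtained (up to isomorphism) as the last term $G=G_{m}$ of a sequence $G_{1},G_{2},\dots,G_{m}$ ($m\geq1$) of unicycle graphs such that: (i) $G_{1}$ is obtained from a cycle of even order $k$ (so $k\ge 4$) with vertices $x_{1},x_{2},\dots,x_{k}$ in this cyclic order by adding $\frac{k}{2}$ pendent edges, exactly one of them incident to $x_{2i-1}$ for each $i\in\{1,\dots,\frac{k}{2}\}$ (that is, one new leaf is attached to each of $x_{1},x_{3},\dots,x_{k-1}$); (ii) if $m\geq2$, then for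 each $1\le i<m$ the graph $G_{i+1}$ is obtained from $G_{i}$ by one of the following two operations. Operation O1: add a new vertex and join it by an edge to any support vertex of $G_{i}$. Operation O2: add a new path $P_{3}=abc$ (three new vertices $a,b,c$ with edges $ab$, $bc$) and join its end vertex $a$ by an edge to any support vertex of $G_{i}$. *)

theory Defs
  imports Complex_Main "Graph_Theory.Digraph_Component"
begin

text \<open>
  A finite simple graph is a \<^locale>\<open>pair_graph\<close>: finite vertex set, symmetric irreflexive arc set.
  An undirected edge between \<open>u\<close> and \<open>v\<close> is the pair of arcs \<open>(u, v)\<close>, \<open>(v, u)\<close>.
\<close>

definition sym_arcs :: "'a rel \<Rightarrow> 'a rel" where
  "sym_arcs E = E \<union> E\<inverse>"

text \<open>
  In a symmetric digraph \<^const>\<open>pre_digraph.cycle\<close> also admits the closed walks \<open>u, v, u\<close>, which the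
  bound on the length excludes. A cycle is identified with its set of undirected edges, so
  that the starting point and the direction of traversal do not matter.
\<close>

definition graph_cycles :: "'a pair_pre_digraph \<Rightarrow> 'a set set set" where
  "graph_cycles G =
     {(\<lambda>(u, v). {u, v}) ` set p | p. pre_digraph.cycle (with_proj G) p \<and> 3 \<le> length p}"

definition unicycle_graph :: "'a pair_pre_digraph \<Rightarrow> bool" where
  "unicycle_graph G \<longleftrightarrow> pair_graph G \<and> (\<exists>!C. C \<in> graph_cycles G)"

definition open_nbhd :: "'a pair_pre_digraph \<Rightarrow> 'a \<Rightarrow> 'a set" where
  "open_nbhd G v = {u \<in> pverts G. (u, v) \<in> parcs G}"

definition closed_nbhd :: "'a pair_pre_digraph \<Rightarrow> 'a \<Rightarrow> 'a set" where
  "closed_nbhd G v = open_nbhd G v \<union> {v}"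

definition vertex_degree :: "'a pair_pre_digraph \<Rightarrow> 'a \<Rightarrow> nat" where
  "vertex_degree G v = card (open_nbhd G v)"

definition leaves :: "'a pair_pre_digraph \<Rightarrow> 'a set" where
  "leaves G = {v \<in> pverts G. vertex_degree G v = 1}"

definition support_vertices :: "'a pair_pre_digraph \<Rightarrow> 'a set" where
  "support_vertices G = {v \<in> pverts G. \<exists>u \<in> leaves G. u \<in> open_nbhd G v}"

definition dominating_set :: "'a pair_pre_digraph \<Rightarrow> 'a set \<Rightarrow> bool" where
  "dominating_set G S \<longleftrightarrow>
     S \<subseteq> pverts G \<and> (\<forall>v \<in> pverts G - S. \<exists>u \<in> S. u \<in> open_nbhd G v)"

definition global_offensive_alliance :: "'a pair_pre_digraph \<Rightarrow> 'a set \<Rightarrow> bool" where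
  "global_offensive_alliance G S \<longleftrightarrow>
     dominating_set G S \<and>
     (\<forall>v \<in> pverts G - S. card (closed_nbhd G v \<inter> S) \<ge> card (closed_nbhd G v - S))"

definition global_offensive_alliance_number :: "'a pair_pre_digraph \<Rightarrow> nat" where
  "global_offensive_alliance_number G = Min (card ` {S. global_offensive_alliance G S})"

text \<open>
  Cycle \<open>x 1, \<dots>, x k\<close> with a pendent vertex \<open>y i\<close> attached to \<open>x (2 * i - 1)\<close> for \<open>1 \<le> i \<le> k / 2\<close>.
\<close>

definition pendent_even_cycle :: "nat \<Rightarrow> (nat \<Rightarrow> 'a) \<Rightarrow> (nat \<Rightarrow> 'a) \<Rightarrow> 'a pair_pre_digraph" where
  "pendent_even_cycle k x y =
     \<lparr> pverts = x ` {1..k} \<union> y ` {1..k div 2},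
       parcs = sym_arcs
         ({(x i, x (i + 1)) | i. i \<in> {1..<k}} \<union> {(x k, x 1)}
          \<union> {(x (2 * i - 1), y i) | i. i \<in> {1..k div 2}}) \<rparr>"

text \<open>The arguments \<open>v\<close> are the existing vertices to which the new ones are joined.\<close>

definition op1 :: "'a pair_pre_digraph \<Rightarrow> 'a \<Rightarrow> 'a \<Rightarrow> 'a pair_pre_digraph" where
  "op1 G v a =
     \<lparr> pverts = pverts G \<union> {a}, parcs = parcs G \<union> sym_arcs {(v, a)} \<rparr>"

definition op2 :: "'a pair_pre_digraph \<Rightarrow> 'a \<Rightarrow> 'a \<Rightarrow> 'a \<Rightarrow> 'a \<Rightarrow> 'a pair_pre_digraph" where
  "op2 G v a b c =
     \<lparr> pverts = pverts G \<union> {a, b, c},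
       parcs = parcs G \<union> sym_arcs {(v, a), (a, b), (b, c)} \<rparr>"

text \<open>
  The names of the cycle vertices, the pendent vertices and all vertices added later are
  arbitrary elements of \<open>'a\<close>, so the family is closed under isomorphism. All graphs in a
  construction sequence have their vertices among those of the last one, so restricting the
  sequence to graphs over \<open>'a\<close> loses nothing.
\<close>

inductive_set family_G :: "'a pair_pre_digraph set" where
  base:
    "\<lbrakk>even k; 4 \<le> k; inj_on x {1..k}; inj_on y {1..k div 2};
      x ` {1..k} \<inter> y ` {1..k div 2} = {}; unicycle_graph (pendent_even_cycle k x y)\<rbrakk>
     \<Longrightarrow> pendent_even_cycle k x y \<in> family_G"
| O1:
    "\<lbrakk>G \<in> family_G; v \<in> support_vertices G; a \<notin> pverts G; unicycle_graph (op1 G v a)\<rbrakk>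
     \<Longrightarrow> op1 G v a \<in> family_G"
| O2:
    "\<lbrakk>G \<in> family_G; v \<in> support_vertices G; {a, b, c} \<inter> pverts G = {}; distinct [a, b, c];
      unicycle_graph (op2 G v a b c)\<rbrakk>
     \<Longrightarrow> op2 G v a b c \<in> family_G"

end

theory Submission
  imports Defs
begin

text \<open>
  Let \<open>S\<close> be a global offensive alliance, \<open>L\<close> the set of leaves, \<open>P\<close> the set of support vertices,
  \<open>T = (S - L) \<union> P\<close> and \<open>H = V - L - T\<close>. A support vertex outside \<open>S\<close> has all its leaves in \<open>S\<close>,
  so \<open>|T| \<le> |S|\<close>. A vertex of \<open>H\<close> is not a leaf, hence has at least two neighbours in \<open>T\<close>. A
  unicycle graph has at most \<open>n\<close> edges, so \<open>l + 2 |H| \<le> n = l + |T| + |H|\<close>, that is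
  \<open>|H| \<le> |T|\<close>. Therefore \<open>3 |S| \<ge> |T| + |H| + |P| = n - l + s\<close>.

  Equality forces \<open>T = P\<close>, \<open>|H| = |P|\<close>, and no edges except those between \<open>P\<close> and \<open>L\<close> and exactly
  two from each vertex of \<open>H\<close> to \<open>P\<close>. In such a graph one can undo O1 at a support vertex with two
  leaves, and O2 at a support vertex with one leaf and one further neighbour. If neither
  applies, double counting shows that each support vertex has exactly two neighbours in \<open>H\<close>, so that
  the non-leaves form the unique cycle and \<open>G\<close> is a starting graph of the family.
\<close>

section \<open>Elementary facts on pair graphs and neighbourhoods\<close>

lemma pair_graph_iff:
  "pair_graph G \<longleftrightarrow> finite (pverts G) \<and>
     (\<forall>u v. (u, v) \<in> parcs G \<longrightarrow> u \<in> pverts G \<and> v \<in> pverts G \<and> u \<noteq> v \<and> (v, u) \<in> parcs G)"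
  (is "_ \<longleftrightarrow> ?R")
proof
  assume "pair_graph G"
  then interpret pair_graph G .
  show ?R
    using pair_finite_verts in_arcsD1 in_arcsD2 pair_no_loops arcs_symmetric by fastforce
next
  assume R: ?R
  then have "parcs G \<subseteq> pverts G \<times> pverts G" by auto
  then have "finite (parcs G)" using R finite_subset by blast
  moreover have "symmetric (with_proj G)"
    using R by (auto simp: symmetric_def intro: symI)
  ultimately show "pair_graph G"
    using R by unfold_locales auto
qed

lemma open_nbhd_iff: "pair_graph G \<Longrightarrow> u \<in> open_nbhd G v \<longleftrightarrow> (v, u) \<in> parcs G"
  by (auto simp: open_nbhd_def pair_graph_iff)

lemma finite_open_nbhd: "pair_graph G \<Longrightarrow> finite (open_nbhd G v)"
  by (auto simp: open_nbhd_def pair_graph_iff)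

lemma finite_parcs: "pair_graph G \<Longrightarrow> finite (parcs G)"
  by (simp add: pair_fin_digraph.pair_finite_arcs pair_graph_def pair_digraph_def)

subsection \<open>Cycles\<close>

text \<open>The first vertex is repeated at index \<open>k\<close>, so that the closing arc has the
  same form as the others and no arithmetic modulo \<open>k\<close> is required.\<close>

definition cyclic_seq :: "'a pair_pre_digraph \<Rightarrow> (nat \<Rightarrow> 'a) \<Rightarrow> nat \<Rightarrow> bool" where
  "cyclic_seq G x k \<longleftrightarrow>
     3 \<le> k \<and> inj_on x {..<k} \<and> x k = x 0 \<and> (\<forall>i<k. (x i, x (Suc i)) \<in> parcs G)"

lemma length_pawalk_verts: "length (pawalk_verts u p) = Suc (length p)"
  by (induct p arbitrary: u) auto

lemma pcas_nth:
  assumes "pcas u p v" "i < length p"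
  shows "p ! i = (pawalk_verts u p ! i, pawalk_verts u p ! Suc i)"
  using assms
proof (induct p arbitrary: u i)
  case (Cons e p)
  have "pawalk_verts (snd e) p ! 0 = snd e" by (cases p) (use Cons.prems in auto)
  then show ?case using Cons by (cases i) auto
qed simp

lemma pcas_last: "pcas u p v \<Longrightarrow> pawalk_verts u p ! length p = v"
  by (induct p arbitrary: u) auto

lemma pawalk_verts_0: "pcas u p v \<Longrightarrow> pawalk_verts u p ! 0 = u"
  by (cases p) auto

lemma pcas_map:
  "pcas (x 0) (map (\<lambda>i. (x i, x (Suc i))) [0..<k]) (x k)"
  "pawalk_verts (x 0) (map (\<lambda>i. (x i, x (Suc i))) [0..<k]) = map x [0..<Suc k]"
proof (induct k arbitrary: x)
  case (Suc k)
  { case 1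
    \<comment> \<open>Walks are consumed from the front, so the first arc is split off and the
      induction hypothesis is applied to the shifted sequence.\<close>
    show ?case using Suc(1)[of "\<lambda>i. x (Suc i)"]
      by (simp add: upt_conv_Cons map_Suc_upt[symmetric] comp_def del: upt_Suc)
  next
    case 2
    show ?case using Suc(2)[of "\<lambda>i. x (Suc i)"]
      by (simp add: upt_conv_Cons map_Suc_upt[symmetric] comp_def del: upt_Suc)
  }
qed auto

text \<open>Replaces arc lists by indexed vertex sequences: from a walk, read off its vertex list;
  from a sequence, \<open>pcas_map\<close> gives the walk. Distinctness is stated for indices 1 to
  \<open>k\<close> on one side and 0 to \<open>k - 1\<close> on the other; \<open>x k = x 0\<close>
  moves between the two.\<close>

lemma graph_cycles_eq:
  assumes "pair_graph G"
  shows "graph_cycles G = {(\<lambda>i. {x i, x (Suc i)}) ` {..<k} | x k. cyclic_seq G x k}"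
proof (intro set_eqI iffI)
  fix C assume "C \<in> graph_cycles G"
  then obtain p u where C: "C = (\<lambda>(u, v). {u, v}) ` set p" and l: "3 \<le> length p"
    and p: "set p \<subseteq> parcs G" "pcas u p u" and d: "distinct (tl (pawalk_verts u p))"
    unfolding graph_cycles_def pre_digraph.cycle_def pre_digraph.awalk_def
      cas_with_proj_eq awalk_verts_with_proj_eq by auto
  define x where "x = (!) (pawalk_verts u p)"
  define k where "k = length p"
  have nth: "p ! i = (x i, x (Suc i))" if "i < k" for i
    using pcas_nth[OF p(2)] that by (simp add: x_def k_def)
  have xk: "x k = x 0" using pcas_last[OF p(2)] pawalk_verts_0[OF p(2)] by (simp add: x_def k_def)
  have tl: "tl (pawalk_verts u p) ! i = x (Suc i)" if "i < k" for i
    using that by (simp add: x_def nth_tl length_pawalk_verts k_def)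
  have inj1: "i = j" if "i < k" "j < k" "x (Suc i) = x (Suc j)" for i j
    using d that tl nth_eq_iff_index_eq[OF d, of i j] by (simp add: length_pawalk_verts k_def)
  have "inj_on x {..<k}"
  proof (rule inj_onI)
    fix i j assume ij: "i \<in> {..<k}" "j \<in> {..<k}" "x i = x j"
    \<comment> \<open>Every index below \<open>k\<close> is rewritten as a successor, with 0
      represented by \<open>k\<close>, so that \<open>inj1\<close> applies.\<close>
    have *: "\<exists>m<k. x n = x (Suc m) \<and> n = (if Suc m = k then 0 else Suc m)" if "n < k" for n
      using that xk by (cases n) (auto intro: exI[of _ "k - 1"])
    from *[of i] *[of j] ij inj1 show "i = j" by auto
  qed
  moreover have "(x i, x (Suc i)) \<in> parcs G" if "i < k" for i
    using nth[OF that] p(1) that by (metis k_def nth_mem subsetD)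
  ultimately have "cyclic_seq G x k"
    using l xk by (simp add: cyclic_seq_def k_def)
  moreover have "C = (\<lambda>i. {x i, x (Suc i)}) ` {..<k}"
  proof -
    have "set p = (\<lambda>i. (x i, x (Suc i))) ` {..<k}"
      using nth unfolding set_conv_nth k_def by (auto simp: image_iff) (metis)
    then show ?thesis unfolding C by (auto simp: image_image)
  qed
  ultimately show "C \<in> {(\<lambda>i. {x i, x (Suc i)}) ` {..<k} | x k. cyclic_seq G x k}" by blast
next
  fix C assume "C \<in> {(\<lambda>i. {x i, x (Suc i)}) ` {..<k} | x k. cyclic_seq G x k}"
  then obtain x k where C: "C = (\<lambda>i. {x i, x (Suc i)}) ` {..<k}" and x: "cyclic_seq G x k" by blast
  define p where "p = map (\<lambda>i. (x i, x (Suc i))) [0..<k]"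
  have "pcas (x 0) p (x 0)" using pcas_map(1)[of x k] x by (simp add: p_def cyclic_seq_def)
  moreover have "tl (pawalk_verts (x 0) p) = map x [1..<Suc k]"
    using pcas_map(2)[of x k] by (simp add: p_def map_tl[symmetric] del: upt_Suc)
  moreover have "inj_on x {1..<Suc k}"
  proof (rule inj_onI)
    fix i j assume ij: "i \<in> {1..<Suc k}" "j \<in> {1..<Suc k}" "x i = x j"
    show "i = j"
      using x ij inj_onD[of x "{..<k}" "if i = k then 0 else i" "if j = k then 0 else j"]
      by (cases "i = k"; cases "j = k") (auto simp: cyclic_seq_def)
  qed
  moreover have "set p \<subseteq> parcs G" using x by (auto simp: p_def cyclic_seq_def)
  moreover have "x 0 \<in> pverts G"
    using x assms by (fastforce simp: cyclic_seq_def pair_graph_iff)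
  ultimately have "pre_digraph.cycle (with_proj G) p"
    using x unfolding pre_digraph.cycle_def pre_digraph.awalk_def
      cas_with_proj_eq awalk_verts_with_proj_eq
    by (intro exI[of _ "x 0"]) (auto simp: distinct_map p_def cyclic_seq_def simp del: upt_Suc)
  moreover have "C = (\<lambda>(u, v). {u, v}) ` set p" by (auto simp: C p_def)
  moreover have "3 \<le> length p" using x by (simp add: p_def cyclic_seq_def)
  ultimately show "C \<in> graph_cycles G" unfolding graph_cycles_def by blast
qed

text \<open>The index \<open>j\<close> is the cyclic predecessor of \<open>i\<close>. Length at
  least 3 is what separates predecessor from successor.\<close>

lemma cyclic_seq_nbrs:
  assumes "cyclic_seq G x k" "pair_graph G" "i < k"
  obtains j where "j < k" "x j \<noteq> x (Suc i)" "{x (Suc i), x j} \<subseteq> open_nbhd G (x i)"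
    "Suc j = i \<or> i = 0 \<and> Suc j = k"
proof -
  define j where "j = (if i = 0 then k - 1 else i - 1)"
  have x: "3 \<le> k" "inj_on x {..<k}" "x k = x 0" "\<And>i. i<k \<Longrightarrow> (x i, x (Suc i)) \<in> parcs G"
    using assms(1) by (auto simp: cyclic_seq_def)
  have j: "j < k" "x (Suc j) = x i" "Suc j = i \<or> i = 0 \<and> Suc j = k"
    using x assms(3) by (auto simp: j_def)
  have "x j \<noteq> x (Suc i)"
  proof
    assume e: "x j = x (Suc i)"
    show False
    proof (cases "Suc i = k")
      case True
      then have "j = 0" using e x j(1) by (auto dest: inj_onD)
      then show False using True j(3) x(1) by (auto simp: j_def)
    next
      case False
      then have "j = Suc i" using e x j(1) assms(3) by (auto dest: inj_onD)
      then show False using x(1) False assms(3) by (auto simp: j_def split: if_splits)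
    qed
  qed
  moreover have "(x i, x j) \<in> parcs G" using x(4)[OF j(1)] j(2) assms(2) by (auto simp: pair_graph_iff)
  ultimately show thesis
    using that[OF j(1)] x(4)[OF assms(3)] j(3) by (simp add: open_nbhd_iff assms(2))
qed

text \<open>Predecessor and successor on the cycle are two different neighbours. This keeps leaves
  and newly attached pendent vertices off every cycle.\<close>

lemma cyclic_seq_degree:
  assumes "cyclic_seq G x k" "pair_graph G" "i \<le> k"
  shows "2 \<le> vertex_degree G (x i)" "x i \<in> pverts G"
proof -
  obtain i' where i': "i' < k" "x i = x i'"
    using assms by (cases "i = k") (auto simp: cyclic_seq_def intro: that[of i] that[of 0])
  obtain j where "x j \<noteq> x (Suc i')" "{x (Suc i'), x j} \<subseteq> open_nbhd G (x i')"
    using cyclic_seq_nbrs[OF assms(1,2) i'(1)] by blast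
  then have "card {x (Suc i'), x j} \<le> card (open_nbhd G (x i'))" "card {x (Suc i'), x j} = 2"
    using card_mono[OF finite_open_nbhd[OF assms(2)], of "{x (Suc i'), x j}"]
    by (simp_all add: card_insert_if)
  then show "2 \<le> vertex_degree G (x i)" by (simp add: vertex_degree_def i')
  show "x i \<in> pverts G" using i' assms(1,2) by (auto simp: cyclic_seq_def pair_graph_iff)
qed

text \<open>Longest path argument: the first vertex of a longest path has a neighbour other than the
  second vertex. That neighbour already lies on the path, since otherwise it could be prepended, and
  so it closes a cycle.\<close>

lemma exists_cyclic_seq:
  assumes G: "pair_graph G" and ne: "pverts G \<noteq> {}"
    and deg: "\<And>v. v \<in> pverts G \<Longrightarrow> 2 \<le> vertex_degree G v"
  shows "\<exists>x k. cyclic_seq G x k"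
proof -
  define path where "path p n \<longleftrightarrow> inj_on p {..n} \<and> p ` {..n} \<subseteq> pverts G \<and>
    (\<forall>i<n. (p i, p (Suc i)) \<in> parcs G)" for p n
  have fin: "finite (pverts G)" using G by (simp add: pair_graph_iff)
  obtain v where v: "v \<in> pverts G" using ne by blast
  have "path (\<lambda>_. v) 0" using v by (auto simp: path_def)
  \<comment> \<open>Injectivity bounds the length of a path by the number of vertices, so a longest
    path exists.\<close>
  moreover have "n < Suc (card (pverts G))" if ex: "\<exists>p. path p n" for n
  proof -
    obtain p where "inj_on p {..n}" "p ` {..n} \<subseteq> pverts G" using ex unfolding path_def by blast
    from card_inj_on_le[OF this fin] show ?thesis by simp
  qed
  ultimately obtain n p where p: "path p n" and mx: "\<And>m q. path q m \<Longrightarrow> m \<le> n"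
    using ex_has_greatest_nat[of "\<lambda>n. \<exists>p. path p n" 0 "\<lambda>n. n" "Suc (card (pverts G))"] by metis
  have p0: "p 0 \<in> pverts G" using p by (auto simp: path_def)
  \<comment> \<open>For \<open>n = 0\<close> the value \<open>p 1\<close> is arbitrary; degree two
    still leaves a neighbour that differs from it.\<close>
  obtain w where w: "(p 0, w) \<in> parcs G" "w \<noteq> p 1"
  proof -
    have "\<not> open_nbhd G (p 0) \<subseteq> {p 1}"
      using deg[OF p0] card_mono[of "{p 1}" "open_nbhd G (p 0)"] by (auto simp: vertex_degree_def)
    then obtain w where "w \<in> open_nbhd G (p 0)" "w \<noteq> p 1" by blast
    then show thesis using that G by (simp add: open_nbhd_iff)
  qed
  have w': "w \<in> pverts G" "w \<noteq> p 0" "(w, p 0) \<in> parcs G" using w G by (auto simp: pair_graph_iff)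
  have "w \<in> p ` {..n}"
  proof (rule ccontr)
    assume nw: "w \<notin> p ` {..n}"
    \<comment> \<open>\<open>case_nat w p\<close> is the path with \<open>w\<close> put in
      front.\<close>
    have "path (case_nat w p) (Suc n)"
      unfolding path_def
    proof (intro conjI allI impI)
      show "inj_on (case_nat w p) {..Suc n}"
      proof (rule inj_onI)
        fix i j assume "i \<in> {..Suc n}" "j \<in> {..Suc n}" "case_nat w p i = case_nat w p j"
        then show "i = j"
          using p nw by (cases i; cases j) (auto simp: path_def dest: inj_onD)
      qed
      show "case_nat w p ` {..Suc n} \<subseteq> pverts G"
      proof (rule image_subsetI)
        fix i assume "i \<in> {..Suc n}"
        then show "case_nat w p i \<in> pverts G" using p w' by (cases i) (auto simp: path_def)
      qed
      fix i assume "i < Suc n"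
      then show "(case_nat w p i, case_nat w p (Suc i)) \<in> parcs G"
        using p w' by (cases i) (auto simp: path_def)
    qed
    then show False using mx by (meson Suc_n_not_le_n)
  qed
  then obtain j where j: "j \<le> n" "w = p j" by auto
  have "j \<noteq> 0" "j \<noteq> 1" using j w w' by metis+
  \<comment> \<open>The cycle runs from \<open>p 0\<close> to \<open>p j = w\<close> and returns to
    \<open>p 0\<close>; the sequence differs from \<open>p\<close> only at the closing index
    \<open>Suc j\<close>.\<close>
  moreover have "inj_on (\<lambda>i. if i = Suc j then p 0 else p i) {..<Suc j} = inj_on p {..<Suc j}"
    by (rule inj_on_cong) auto
  moreover have "inj_on p {..<Suc j}"
    using p j by (auto simp: path_def intro: inj_on_subset)
  ultimately have "cyclic_seq G (\<lambda>i. if i = Suc j then p 0 else p i) (Suc j)"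
    using p j w' by (auto simp: cyclic_seq_def path_def less_Suc_eq)
  then show ?thesis by blast
qed

section \<open>Vertex deletion and the number of edges\<close>

definition delete_vertex :: "'a pair_pre_digraph \<Rightarrow> 'a \<Rightarrow> 'a pair_pre_digraph" where
  "delete_vertex G a = \<lparr> pverts = pverts G - {a}, parcs = {(u, v) \<in> parcs G. u \<noteq> a \<and> v \<noteq> a} \<rparr>"

lemma pair_graph_delete_vertex: "pair_graph G \<Longrightarrow> pair_graph (delete_vertex G a)"
  by (auto simp: pair_graph_iff delete_vertex_def)

lemma cyclic_seq_mono: "cyclic_seq G x k \<Longrightarrow> parcs G \<subseteq> parcs H \<Longrightarrow> cyclic_seq H x k"
  by (auto simp: cyclic_seq_def)

text \<open>Each edge at \<open>a\<close> accounts for two arcs, one starting and one ending in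
  \<open>a\<close>; as there are no loops, these are different.\<close>

lemma card_parcs_delete_vertex:
  assumes "pair_graph G"
  shows "card (parcs G) = card (parcs (delete_vertex G a)) + 2 * vertex_degree G a"
proof -
  let ?N = "open_nbhd G a"
  have "parcs G = parcs (delete_vertex G a) \<union> ({a} \<times> ?N \<union> ?N \<times> {a})"
    using assms by (auto simp: delete_vertex_def open_nbhd_iff pair_graph_iff)
  moreover have "card ({a} \<times> ?N \<union> ?N \<times> {a}) = 2 * card ?N"
    using assms finite_open_nbhd[OF assms, of a]
    by (subst card_Un_disjoint) (auto simp: card_cartesian_product open_nbhd_iff, auto simp: pair_graph_iff)
  moreover have "parcs (delete_vertex G a) \<inter> ({a} \<times> ?N \<union> ?N \<times> {a}) = {}"
    by (auto simp: delete_vertex_def)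
  ultimately show ?thesis
    using finite_parcs[OF assms] finite_open_nbhd[OF assms, of a]
    by (metis card_Un_disjoint finite_Un vertex_degree_def)
qed

text \<open>With two arcs per edge this is the bound \<open>n - 1\<close> on the edges of a forest.
  By \<open>exists_cyclic_seq\<close> some vertex has degree at most one; deleting it costs at most
  two arcs and creates no cycle.\<close>

lemma acyclic_card_parcs:
  assumes "pair_graph G" "pverts G \<noteq> {}" "\<nexists>x k. cyclic_seq G x k"
  shows "card (parcs G) + 2 \<le> 2 * card (pverts G)"
  using assms
proof (induct "card (pverts G)" arbitrary: G rule: less_induct)
  case less
  have fin: "finite (pverts G)" using less(2) by (simp add: pair_graph_iff)
  obtain v where v: "v \<in> pverts G" "vertex_degree G v \<le> 1"
    using exists_cyclic_seq[OF less(2,3)] less(4) by (metis One_nat_def not_less_eq_eq numeral_2_eq_2)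
  let ?H = "delete_vertex G v"
  have c: "card (pverts G) = Suc (card (pverts ?H))"
    using card.remove[OF fin v(1)] by (simp add: delete_vertex_def)
  show ?case
  proof (cases "pverts ?H = {}")
    case True
    then have "pverts G = {v}" using v by (auto simp: delete_vertex_def)
    then have "parcs G = {}" using less(2) by (auto simp: pair_graph_iff)
    then show ?thesis using c by simp
  next
    case False
    have "\<nexists>x k. cyclic_seq ?H x k"
    proof
      assume "\<exists>x k. cyclic_seq ?H x k"
      then obtain x k where "cyclic_seq ?H x k" by blast
      then have "cyclic_seq G x k" by (rule cyclic_seq_mono) (auto simp: delete_vertex_def)
      then show False using less(4) by blast
    qed
    then have "card (parcs ?H) + 2 \<le> 2 * card (pverts ?H)"
      using less(1)[of ?H] c pair_graph_delete_vertex[OF less(2)] False by simp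
    then show ?thesis using card_parcs_delete_vertex[OF less(2), of v] v c by simp
  qed
qed

text \<open>Removing one edge of the only cycle leaves a forest, so the forest bound is exceeded by
  at most one edge.\<close>

lemma unicycle_card_parcs:
  assumes "unicycle_graph G"
  shows "card (parcs G) \<le> 2 * card (pverts G)"
proof -
  have G: "pair_graph G" and uni: "\<And>C D. C \<in> graph_cycles G \<Longrightarrow> D \<in> graph_cycles G \<Longrightarrow> C = D"
    and ex: "graph_cycles G \<noteq> {}"
    using assms by (auto simp: unicycle_graph_def)
  obtain x k where x: "cyclic_seq G x k" using ex by (auto simp: graph_cycles_eq[OF G])
  have e: "(x 0, x 1) \<in> parcs G" "0 < k" using x by (auto simp: cyclic_seq_def)
  define H where "H = \<lparr> pverts = pverts G, parcs = parcs G - {(x 0, x 1), (x 1, x 0)} \<rparr>"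
  have H: "pair_graph H" using G by (auto simp: H_def pair_graph_iff)
  \<comment> \<open>A cycle surviving in \<open>H\<close> would have the same edge set as the cycle
    \<open>x\<close> and hence use the deleted edge.\<close>
  have "\<not> cyclic_seq H y m" for y m
  proof
    assume y: "cyclic_seq H y m"
    then have "cyclic_seq G y m" by (rule cyclic_seq_mono) (auto simp: H_def)
    then have "(\<lambda>i. {y i, y (Suc i)}) ` {..<m} = (\<lambda>i. {x i, x (Suc i)}) ` {..<k}"
      using x by (intro uni) (auto simp: graph_cycles_eq[OF G])
    moreover have "{x 0, x 1} \<in> (\<lambda>i. {x i, x (Suc i)}) ` {..<k}" using e by force
    ultimately obtain i where "i < m" "{x 0, x 1} = {y i, y (Suc i)}" by (metis (no_types, lifting) imageE lessThan_iff)
    then show False using y by (auto simp: cyclic_seq_def H_def doubleton_eq_iff)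
  qed
  then have "card (parcs H) + 2 \<le> 2 * card (pverts G)"
    using acyclic_card_parcs[OF H] cyclic_seq_degree(2)[OF x G, of 0] by (auto simp: H_def)
  moreover have "card (parcs G) \<le> card (parcs H) + 2"
  proof -
    have "parcs G \<subseteq> parcs H \<union> {(x 0, x 1), (x 1, x 0)}" by (auto simp: H_def)
    then have "card (parcs G) \<le> card (parcs H \<union> {(x 0, x 1), (x 1, x 0)})"
      using finite_parcs[OF H] by (intro card_mono) auto
    also have "\<dots> \<le> card (parcs H) + card {(x 0, x 1), (x 1, x 0)}" by (rule card_Un_le)
    also have "\<dots> \<le> card (parcs H) + 2"
      by (rule add_left_mono, rule order_trans[OF card_insert_le_m1]) auto
    finally show ?thesis .
  qed
  ultimately show ?thesis by linarith
qed

subsection \<open>Attaching and removing pendent vertices\<close>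

text \<open>Connectedness in closure form: an argument exhibits a nonempty set closed under arcs and
  concludes that it is everything, without handling walks.\<close>

definition arc_connected :: "'a pair_pre_digraph \<Rightarrow> bool" where
  "arc_connected G \<longleftrightarrow> (\<forall>A. A \<subseteq> pverts G \<longrightarrow> A \<noteq> {} \<longrightarrow>
     (\<forall>u w. u \<in> A \<longrightarrow> (u, w) \<in> parcs G \<longrightarrow> w \<in> A) \<longrightarrow> A = pverts G)"

lemma connected_imp_arc_connected:
  assumes G: "pair_graph G" and c: "Digraph_Component.connected (with_proj G)"
  shows "arc_connected G"
  unfolding arc_connected_def
proof (intro allI impI)
  fix A assume A: "A \<subseteq> pverts G" "A \<noteq> {}"
    and cl: "\<forall>u w. u \<in> A \<longrightarrow> (u, w) \<in> parcs G \<longrightarrow> w \<in> A"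
  obtain u where u: "u \<in> A" using A by blast
  \<comment> \<open>The arc relation is symmetric already, so the symmetric closure in the library
    notion of connectedness adds nothing.\<close>
  have eq: "parcs (mk_symmetric (with_proj G)) = parcs G"
    using G unfolding mk_symmetric_def by (auto simp: pair_graph_iff)
  have "w \<in> A" if w: "w \<in> pverts G" for w
  proof -
    have "u \<rightarrow>\<^sup>*\<^bsub>with_proj (mk_symmetric (with_proj G))\<^esub> w"
      using c w u A(1) unfolding Digraph_Component.connected_def strongly_connected_def
      by (auto simp: mk_symmetric_def)
    then have "(u, w) \<in> (parcs G)\<^sup>*"
      unfolding reachable_def with_proj_simps eq by (rule rtrancl_on_rtranclI)
    then show "w \<in> A" by (induct rule: rtrancl_induct) (use u cl in auto)
  qed
  then show "A = pverts G" using A by blast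
qed

lemma leaves_subset: "leaves G \<subseteq> pverts G"
  and support_vertices_subset: "support_vertices G \<subseteq> pverts G"
  by (auto simp: leaves_def support_vertices_def)

lemma open_nbhd_empty: "pair_graph G \<Longrightarrow> v \<notin> pverts G \<Longrightarrow> open_nbhd G v = {}"
  by (auto simp: open_nbhd_def pair_graph_iff)

lemma leaf_nbhd:
  assumes "pair_graph G" "u \<in> leaves G" "u \<in> open_nbhd G v"
  shows "open_nbhd G u = {v}"
proof -
  have "v \<in> open_nbhd G u" using assms by (auto simp: open_nbhd_iff pair_graph_iff)
  moreover obtain z where "open_nbhd G u = {z}"
    using assms by (auto simp: leaves_def vertex_degree_def card_1_singleton_iff)
  ultimately show ?thesis by auto
qed

lemma pair_graph_op1:
  "pair_graph G \<Longrightarrow> v \<in> pverts G \<Longrightarrow> a \<notin> pverts G \<Longrightarrow> pair_graph (op1 G v a)"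
  by (auto simp: pair_graph_iff op1_def sym_arcs_def)

lemma open_nbhd_op1:
  assumes "pair_graph G" "v \<in> pverts G" "a \<notin> pverts G"
  shows "open_nbhd (op1 G v a) u =
    (if u = a then {v} else if u = v then insert a (open_nbhd G v) else open_nbhd G u)"
  using assms by (auto simp: open_nbhd_def op1_def sym_arcs_def pair_graph_iff)

text \<open>The new vertex has degree one, while every vertex of a cycle has degree at least
  two.\<close>

lemma cyclic_seq_op1:
  assumes G: "pair_graph G" and v: "v \<in> pverts G" "a \<notin> pverts G"
  shows "cyclic_seq (op1 G v a) x k \<longleftrightarrow> cyclic_seq G x k"
proof
  assume x: "cyclic_seq (op1 G v a) x k"
  have "x i \<noteq> a" if "i \<le> k" for i
    using cyclic_seq_degree(1)[OF x pair_graph_op1[OF assms] that]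
    by (auto simp: vertex_degree_def open_nbhd_op1[OF assms])
  then show "cyclic_seq G x k"
    using x by (auto simp: cyclic_seq_def op1_def sym_arcs_def)
qed (auto intro: cyclic_seq_mono simp: op1_def)

lemma unicycle_graph_op1:
  assumes "pair_graph G" "v \<in> pverts G" "a \<notin> pverts G"
  shows "unicycle_graph (op1 G v a) \<longleftrightarrow> unicycle_graph G"
  using assms pair_graph_op1[OF assms]
  by (simp add: unicycle_graph_def graph_cycles_eq cyclic_seq_op1)

lemma arc_connected_op1D:
  assumes "pair_graph G" "v \<in> pverts G" "a \<notin> pverts G" and c: "arc_connected (op1 G v a)"
  shows "arc_connected G"
  unfolding arc_connected_def
proof (intro allI impI)
  fix A assume A: "A \<subseteq> pverts G" "A \<noteq> {}"
    and cl: "\<forall>u w. u \<in> A \<longrightarrow> (u, w) \<in> parcs G \<longrightarrow> w \<in> A"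
  \<comment> \<open>A closed set of \<open>G\<close> becomes closed in the larger graph once
    \<open>a\<close> joins it exactly when \<open>v\<close> is a member.\<close>
  define B where "B = (if v \<in> A then insert a A else A)"
  have "B \<subseteq> pverts (op1 G v a)" "B \<noteq> {}" using A by (auto simp: B_def op1_def)
  moreover have "w \<in> B" if "u \<in> B" "(u, w) \<in> parcs (op1 G v a)" for u w
    using that cl assms A by (auto simp: B_def op1_def sym_arcs_def pair_graph_iff split: if_splits)
  ultimately have "B = pverts (op1 G v a)" using c by (auto simp: arc_connected_def)
  then show "A = pverts G" using A assms by (auto simp: B_def op1_def split: if_splits)
qed

text \<open>The facts on graphs, cycles and connectedness under \<open>op1\<close> hold at every
  vertex \<open>v\<close> of the graph, so they carry over to O2 by three applications.\<close>

lemma op2_eq_op1: "op2 G v a b c = op1 (op1 (op1 G v a) a b) b c"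
  by (auto simp: op2_def op1_def sym_arcs_def)

lemma
  assumes G: "pair_graph G" and v: "v \<in> pverts G"
    and d: "{a, b, c} \<inter> pverts G = {}" "distinct [a, b, c]"
  shows unicycle_graph_op2: "unicycle_graph (op2 G v a b c) \<longleftrightarrow> unicycle_graph G"
    and arc_connected_op2D: "arc_connected (op2 G v a b c) \<Longrightarrow> arc_connected G"
    and open_nbhd_op2: "open_nbhd (op2 G v a b c) u =
      (if u = c then {b} else if u = b then {a, c} else if u = a then {v, b}
       else if u = v then insert a (open_nbhd G v) else open_nbhd G u)"
proof -
  have a: "a \<notin> pverts G" using d by auto
  let ?H = "op1 G v a"
  have H: "pair_graph ?H" by (rule pair_graph_op1[OF G v a])
  have b: "a \<in> pverts ?H" "b \<notin> pverts ?H" using d by (auto simp: op1_def)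
  let ?I = "op1 ?H a b"
  have I: "pair_graph ?I" by (rule pair_graph_op1[OF H b])
  have c: "b \<in> pverts ?I" "c \<notin> pverts ?I" using d by (auto simp: op1_def)
  show "unicycle_graph (op2 G v a b c) \<longleftrightarrow> unicycle_graph G"
    unfolding op2_eq_op1 unicycle_graph_op1[OF I c] unicycle_graph_op1[OF H b]
      unicycle_graph_op1[OF G v a] ..
  show "arc_connected (op2 G v a b c) \<Longrightarrow> arc_connected G"
    unfolding op2_eq_op1
    using arc_connected_op1D[OF I c] arc_connected_op1D[OF H b] arc_connected_op1D[OF G v a] by blast
  show "open_nbhd (op2 G v a b c) u =
      (if u = c then {b} else if u = b then {a, c} else if u = a then {v, b}
       else if u = v then insert a (open_nbhd G v) else open_nbhd G u)"
    unfolding op2_eq_op1 open_nbhd_op1[OF I c] open_nbhd_op1[OF H b] open_nbhd_op1[OF G v a]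
    using d v open_nbhd_empty[OF G] by auto
qed

lemma support_degree_ge_2:
  assumes "pair_graph G" "v \<in> support_vertices G" "v \<notin> leaves G"
  shows "2 \<le> vertex_degree G v"
proof -
  have "open_nbhd G v \<noteq> {}" "v \<in> pverts G" using assms by (auto simp: support_vertices_def)
  then have "vertex_degree G v \<noteq> 0" "vertex_degree G v \<noteq> 1"
    using assms finite_open_nbhd[OF assms(1), of v] by (auto simp: vertex_degree_def leaves_def)
  then show ?thesis by linarith
qed

lemma vertex_degree_insert:
  "pair_graph G \<Longrightarrow> a \<notin> pverts G \<Longrightarrow> card (insert a (open_nbhd G v)) = Suc (vertex_degree G v)"
  using finite_open_nbhd[of G v] by (auto simp: vertex_degree_def open_nbhd_def)

text \<open>As \<open>v\<close> is a support vertex and not a leaf, its degree is at least two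
  before the operation; hence it does not change its status, and \<open>a\<close> is the only new
  leaf.\<close>

lemma
  assumes G: "pair_graph G" and v: "v \<in> support_vertices G" "v \<notin> leaves G" and a: "a \<notin> pverts G"
  shows leaves_op1: "leaves (op1 G v a) = insert a (leaves G)"
    and support_vertices_op1: "support_vertices (op1 G v a) = support_vertices G"
proof -
  have v': "v \<in> pverts G" using v support_vertices_subset[of G] by blast
  have deg: "vertex_degree (op1 G v a) u = 1 \<longleftrightarrow> u = a \<or> vertex_degree G u = 1" for u
    using support_degree_ge_2[OF G v]
    by (auto simp: vertex_degree_def[of "op1 G v a"] open_nbhd_op1[OF G v' a]
        vertex_degree_insert[OF G a] vertex_degree_def[of G, symmetric])
  show l: "leaves (op1 G v a) = insert a (leaves G)"
    unfolding leaves_def deg by (auto simp: op1_def)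
  show "support_vertices (op1 G v a) = support_vertices G"
    using v a v' leaves_subset[of G] unfolding support_vertices_def l open_nbhd_op1[OF G v' a]
    by (auto simp: op1_def open_nbhd_def)
qed

text \<open>The inner vertices \<open>a\<close> and \<open>b\<close> get degree two, so
  \<open>c\<close> is the only new leaf and \<open>b\<close>, its neighbour, the only new support
  vertex.\<close>

lemma
  assumes G: "pair_graph G" and v: "v \<in> support_vertices G" "v \<notin> leaves G"
    and d: "{a, b, c} \<inter> pverts G = {}" "distinct [a, b, c]"
  shows leaves_op2: "leaves (op2 G v a b c) = insert c (leaves G)"
    and support_vertices_op2: "support_vertices (op2 G v a b c) = insert b (support_vertices G)"
proof -
  have v': "v \<in> pverts G" using v support_vertices_subset[of G] by blast
  then have va: "v \<noteq> a" "v \<noteq> b" "a \<noteq> c" "b \<noteq> a" "b \<noteq> c" and a: "a \<notin> pverts G" using d by auto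
  note nb = open_nbhd_op2[OF G v' d]
  have deg: "vertex_degree (op2 G v a b c) u = 1 \<longleftrightarrow>
      u = c \<or> (u \<noteq> a \<and> u \<noteq> b \<and> vertex_degree G u = 1)" for u
    using support_degree_ge_2[OF G v] va
    by (auto simp: vertex_degree_def[of "op2 G v a b c"] nb
        vertex_degree_insert[OF G a] vertex_degree_def[of G, symmetric])
  show l: "leaves (op2 G v a b c) = insert c (leaves G)"
    unfolding leaves_def deg using d by (auto simp: op2_def)
  show "support_vertices (op2 G v a b c) = insert b (support_vertices G)"
    using v d v' leaves_subset[of G] unfolding support_vertices_def l nb
    by (auto simp: op2_def open_nbhd_def)
qed

subsection \<open>The structure of extremal graphs\<close>

text \<open>
  These are the graphs obtained from a graph on the support vertices with as many edges as
  vertices by subdividing every edge once and attaching at least one leaf to every vertex.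
\<close>

definition subdivided_corona :: "'a pair_pre_digraph \<Rightarrow> bool" where
  "subdivided_corona G \<longleftrightarrow>
     support_vertices G \<inter> leaves G = {} \<and>
     (\<forall>v \<in> support_vertices G. open_nbhd G v \<inter> support_vertices G = {}) \<and>
     (\<forall>v \<in> pverts G - leaves G - support_vertices G.
        vertex_degree G v = 2 \<and> open_nbhd G v \<subseteq> support_vertices G) \<and>
     card (pverts G) = card (leaves G) + 2 * card (support_vertices G)"

lemma finite_leaves: "pair_graph G \<Longrightarrow> finite (leaves G)"
  and finite_support_vertices: "pair_graph G \<Longrightarrow> finite (support_vertices G)"
  by (auto simp: leaves_def support_vertices_def pair_graph_iff)

text \<open>The vertices that are neither leaves nor support vertices stay the same with the same
  neighbours, and both sides of the cardinality equation grow by one. The equivalence serves both to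
  build graphs and to undo the operation.\<close>

lemma subdivided_corona_op1:
  assumes G: "pair_graph G" and v: "v \<in> support_vertices G" "v \<notin> leaves G" and a: "a \<notin> pverts G"
  shows "subdivided_corona (op1 G v a) \<longleftrightarrow> subdivided_corona G"
proof -
  have v': "v \<in> pverts G" using v support_vertices_subset[of G] by blast
  have sets: "a \<notin> leaves G" "a \<notin> support_vertices G" "finite (pverts G)"
    "pverts (op1 G v a) = insert a (pverts G)"
    using a G leaves_subset[of G] support_vertices_subset[of G]
    by (auto simp: pair_graph_iff op1_def)
  have H: "insert a (pverts G) - insert a (leaves G) - support_vertices G =
      pverts G - leaves G - support_vertices G" using a by auto
  have nb: "open_nbhd (op1 G v a) u = open_nbhd G u"
    if "u \<in> pverts G - leaves G - support_vertices G" for u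
    using that v a by (auto simp: open_nbhd_op1[OF G v' a])
  have nb': "open_nbhd (op1 G v a) u \<inter> support_vertices G = open_nbhd G u \<inter> support_vertices G"
    if "u \<in> support_vertices G" for u
    using that sets(2) by (auto simp: open_nbhd_op1[OF G v' a])
  have b1: "(\<forall>u \<in> support_vertices G. open_nbhd (op1 G v a) u \<inter> support_vertices G = {}) \<longleftrightarrow>
      (\<forall>u \<in> support_vertices G. open_nbhd G u \<inter> support_vertices G = {})"
    by (intro ball_cong refl) (simp add: nb')
  have b2: "(\<forall>u \<in> pverts G - leaves G - support_vertices G.
        vertex_degree (op1 G v a) u = 2 \<and> open_nbhd (op1 G v a) u \<subseteq> support_vertices G) \<longleftrightarrow>
      (\<forall>u \<in> pverts G - leaves G - support_vertices G.
        vertex_degree G u = 2 \<and> open_nbhd G u \<subseteq> support_vertices G)"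
    by (intro ball_cong refl) (simp add: nb vertex_degree_def)
  show ?thesis
    unfolding subdivided_corona_def leaves_op1[OF G v a] support_vertices_op1[OF G v a] sets(4) H
      b1 b2
    using sets finite_leaves[OF G] a by simp
qed

text \<open>The vertex \<open>a\<close> becomes a subdivision vertex between the support vertices
  \<open>v\<close> and \<open>b\<close>. Three new vertices are balanced by one new leaf and one new
  support vertex, the latter counted twice.\<close>

lemma subdivided_corona_op2:
  assumes G: "pair_graph G" and v: "v \<in> support_vertices G" "v \<notin> leaves G"
    and d: "{a, b, c} \<inter> pverts G = {}" "distinct [a, b, c]"
  shows "subdivided_corona (op2 G v a b c) \<longleftrightarrow> subdivided_corona G"
proof -
  let ?G = "op2 G v a b c" and ?S = "support_vertices G" and ?L = "leaves G"
  have v': "v \<in> pverts G" using v support_vertices_subset[of G] by blast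
  have sub: "?L \<subseteq> pverts G" "?S \<subseteq> pverts G" by (rule leaves_subset support_vertices_subset)+
  have sets: "pverts ?G = insert a (insert b (insert c (pverts G)))" by (auto simp: op2_def)
  have new: "a \<notin> pverts G" "b \<notin> pverts G" "c \<notin> pverts G" "a \<noteq> b" "a \<noteq> c" "b \<noteq> c"
    "a \<notin> ?L" "a \<notin> ?S" "b \<notin> ?L" "b \<notin> ?S" "c \<notin> ?L" "c \<notin> ?S"
    using d sub by auto
  have Nsub: "open_nbhd G u \<subseteq> pverts G" for u by (auto simp: open_nbhd_def)
  have H: "pverts ?G - insert c ?L - insert b ?S = insert a (pverts G - ?L - ?S)"
    using new by (auto simp: sets)
  have nb: "open_nbhd ?G u = open_nbhd G u" if "u \<in> pverts G - ?L - ?S" for u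
    using that v new by (auto simp: open_nbhd_op2[OF G v' d])
  have nb2: "open_nbhd G u \<subseteq> insert b ?S \<longleftrightarrow> open_nbhd G u \<subseteq> ?S" for u
    using Nsub[of u] new by blast
  have nb': "open_nbhd ?G u \<inter> insert b ?S = open_nbhd G u \<inter> ?S" if "u \<in> ?S" for u
    using that new sub Nsub[of u] v' by (auto simp: open_nbhd_op2[OF G v' d])
  have nba: "open_nbhd ?G a = {v, b}" "v \<noteq> b" using new v' by (auto simp: open_nbhd_op2[OF G v' d])
  have nbb: "open_nbhd ?G b \<inter> insert b ?S = {}" using new by (auto simp: open_nbhd_op2[OF G v' d])
  have disj: "insert b ?S \<inter> insert c ?L = {} \<longleftrightarrow> ?S \<inter> ?L = {}" using new by auto
  have fin: "finite (pverts G)" "finite ?L" "finite ?S"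
    using G finite_leaves finite_support_vertices by (auto simp: pair_graph_iff)
  have card: "card (pverts ?G) = card (insert c ?L) + 2 * card (insert b ?S) \<longleftrightarrow>
      card (pverts G) = card ?L + 2 * card ?S"
    using fin new unfolding sets by simp
  have b1: "(\<forall>u \<in> insert b ?S. open_nbhd ?G u \<inter> insert b ?S = {}) \<longleftrightarrow>
      (\<forall>u \<in> ?S. open_nbhd G u \<inter> ?S = {})"
    unfolding ball_simps using nbb by (simp only: simp_thms) (intro ball_cong refl, simp add: nb')
  have "(\<forall>u \<in> pverts G - ?L - ?S. vertex_degree ?G u = 2 \<and> open_nbhd ?G u \<subseteq> insert b ?S) \<longleftrightarrow>
      (\<forall>u \<in> pverts G - ?L - ?S. vertex_degree G u = 2 \<and> open_nbhd G u \<subseteq> ?S)"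
    by (intro ball_cong refl) (simp add: nb nb2 vertex_degree_def)
  moreover have "vertex_degree ?G a = 2 \<and> open_nbhd ?G a \<subseteq> insert b ?S"
    using v(1) nba by (simp add: vertex_degree_def)
  ultimately have b2: "(\<forall>u \<in> insert a (pverts G - ?L - ?S).
        vertex_degree ?G u = 2 \<and> open_nbhd ?G u \<subseteq> insert b ?S) \<longleftrightarrow>
      (\<forall>u \<in> pverts G - ?L - ?S. vertex_degree G u = 2 \<and> open_nbhd G u \<subseteq> ?S)"
    by simp
  show ?thesis
    unfolding subdivided_corona_def leaves_op2[OF G v d] support_vertices_op2[OF G v d] H disj card
      b1 b2 ..
qed

section \<open>Leaves and support vertices of connected unicycle graphs\<close>

lemma unicycle_graph_pair_graph: "unicycle_graph G \<Longrightarrow> pair_graph G"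
  by (simp add: unicycle_graph_def)

lemma unicycle_obtains_cyclic_seq:
  assumes "unicycle_graph G"
  obtains x k where "cyclic_seq G x k"
proof -
  have "graph_cycles G \<noteq> {}" using assms by (auto simp: unicycle_graph_def)
  then show thesis
    using that unicycle_graph_pair_graph[OF assms] by (auto simp: graph_cycles_eq)
qed

lemma goa_subset: "global_offensive_alliance G S \<Longrightarrow> S \<subseteq> pverts G"
  by (simp add: global_offensive_alliance_def dominating_set_def)

lemma finite_goa: "pair_graph G \<Longrightarrow> global_offensive_alliance G S \<Longrightarrow> finite S"
  using finite_subset[OF goa_subset] by (auto simp: pair_graph_iff)

text \<open>Otherwise \<open>v\<close> and its leaves form a closed set, so the graph is a star
  centred at \<open>v\<close>. Cycle vertices have degree at least two and would all coincide with
  \<open>v\<close>.\<close>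

lemma support_has_nonleaf_nbr:
  assumes U: "unicycle_graph G" and c: "arc_connected G" and v: "v \<in> support_vertices G"
  shows "\<exists>h \<in> open_nbhd G v. h \<notin> leaves G"
proof (rule ccontr)
  assume "\<not> ?thesis"
  then have N: "open_nbhd G v \<subseteq> leaves G" by blast
  note G = unicycle_graph_pair_graph[OF U]
  let ?A = "insert v (open_nbhd G v)"
  have "w \<in> ?A" if u: "u \<in> ?A" and uw: "(u, w) \<in> parcs G" for u w
  proof (cases "u = v")
    case False
    then have "open_nbhd G u = {v}" using leaf_nbhd[OF G] N u by blast
    then show ?thesis using uw by (auto simp: open_nbhd_iff[OF G, symmetric])
  qed (use uw in \<open>simp add: open_nbhd_iff[OF G]\<close>)
  moreover have "?A \<subseteq> pverts G"
    using v support_vertices_subset[of G] by (auto simp: open_nbhd_def)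
  ultimately have V: "pverts G = ?A" using c unfolding arc_connected_def by blast
  obtain x k where x: "cyclic_seq G x k" using U by (rule unicycle_obtains_cyclic_seq)
  have "x i = v" if "i \<le> k" for i
    using cyclic_seq_degree[OF x G that] V N by (auto simp: leaves_def)
  then have "x 0 = x 1" "0 < k" "1 < k" using x by (auto simp: cyclic_seq_def)
  then show False using x by (auto simp: cyclic_seq_def dest: inj_onD)
qed

text \<open>A leaf that supports a leaf has that leaf as its only neighbour, which contradicts
  \<open>support_has_nonleaf_nbr\<close>.\<close>

lemma support_disjoint_leaves:
  assumes U: "unicycle_graph G" and c: "arc_connected G"
  shows "support_vertices G \<inter> leaves G = {}"
proof -
  note G = unicycle_graph_pair_graph[OF U]
  have False if v: "v \<in> support_vertices G" "v \<in> leaves G" for v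
  proof -
    obtain u where u: "u \<in> leaves G" "u \<in> open_nbhd G v"
      using v by (auto simp: support_vertices_def)
    then have "v \<in> open_nbhd G u" using G by (auto simp: open_nbhd_iff pair_graph_iff)
    then have "open_nbhd G v = {u}" by (rule leaf_nbhd[OF G v(2)])
    then show False using support_has_nonleaf_nbr[OF U c v(1)] u by auto
  qed
  then show ?thesis by blast
qed

subsection \<open>The lower bound\<close>

text \<open>Choose a leaf \<open>f v\<close> for each support vertex \<open>v\<close>. Its only
  neighbour is \<open>v\<close>, so if \<open>v\<close> is missing from \<open>S\<close>, domination
  forces \<open>f v\<close> into \<open>S\<close>; trading \<open>f v\<close> for \<open>v\<close>
  is injective because \<open>f v\<close> determines \<open>v\<close>.\<close>

lemma goa_support_exchange:
  assumes G: "pair_graph G" and S: "global_offensive_alliance G S"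
    and d: "support_vertices G \<inter> leaves G = {}"
  shows "card ((S - leaves G) \<union> support_vertices G) \<le> card S"
proof -
  let ?L = "leaves G" and ?P = "support_vertices G"
  have fin: "finite S" "finite ?P"
    using finite_goa[OF G S] finite_support_vertices[OF G] by auto
  have "\<forall>v \<in> ?P. \<exists>u. u \<in> ?L \<and> u \<in> open_nbhd G v" by (auto simp: support_vertices_def)
  then obtain f where f: "\<And>v. v \<in> ?P \<Longrightarrow> f v \<in> ?L \<and> f v \<in> open_nbhd G v" by metis
  then have Nf: "open_nbhd G (f v) = {v}" if "v \<in> ?P" for v
    using leaf_nbhd[OF G] that by blast
  have "f v \<in> S" if "v \<in> ?P - S" for v
  proof (rule ccontr)
    assume "f v \<notin> S"
    moreover have "f v \<in> pverts G" using f[of v] that leaves_subset[of G] by blast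
    ultimately have "\<exists>u \<in> S. u \<in> open_nbhd G (f v)"
      using S by (auto simp: global_offensive_alliance_def dominating_set_def)
    then show False using Nf that by auto
  qed
  then have "f ` (?P - S) \<subseteq> S \<inter> ?L" using f by blast
  moreover have "inj_on f (?P - S)" by (rule inj_onI) (metis DiffD1 Nf singleton_inject)
  ultimately have "card (?P - S) \<le> card (S \<inter> ?L)" using fin by (intro card_inj_on_le) auto
  moreover have eq: "(S - ?L) \<union> ?P = (S - ?L) \<union> (?P - S)" using d by blast
  moreover have "card ((S - ?L) \<union> (?P - S)) \<le> card (S - ?L) + card (?P - S)" by (rule card_Un_le)
  moreover have "card S = card (S \<inter> ?L) + card (S - ?L)"
    by (rule card_Int_Diff) (rule fin)
  ultimately show ?thesis unfolding eq by linarith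
qed

text \<open>Since \<open>h\<close> itself counts against the alliance, its neighbours in
  \<open>S\<close> strictly outnumber those outside. Just one neighbour in \<open>S\<close> would
  then be its only neighbour and make \<open>h\<close> a leaf.\<close>

lemma goa_two_nbrs:
  assumes G: "pair_graph G" and S: "global_offensive_alliance G S"
    and h: "h \<in> pverts G" "h \<notin> leaves G" "h \<notin> S"
  shows "2 \<le> card (open_nbhd G h \<inter> S)"
proof -
  have fin: "finite (open_nbhd G h)" by (rule finite_open_nbhd[OF G])
  have hN: "h \<notin> open_nbhd G h" using G by (auto simp: open_nbhd_iff pair_graph_iff)
  have "card (closed_nbhd G h - S) \<le> card (closed_nbhd G h \<inter> S)"
    using S h by (auto simp: global_offensive_alliance_def)
  moreover have "closed_nbhd G h - S = insert h (open_nbhd G h - S)"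
    "closed_nbhd G h \<inter> S = open_nbhd G h \<inter> S" using h by (auto simp: closed_nbhd_def)
  ultimately have "Suc (card (open_nbhd G h - S)) \<le> card (open_nbhd G h \<inter> S)"
    using fin hN by simp
  moreover have "vertex_degree G h = card (open_nbhd G h \<inter> S) + card (open_nbhd G h - S)"
    unfolding vertex_degree_def by (rule card_Int_Diff) (rule fin)
  moreover have "vertex_degree G h \<noteq> 1" using h by (auto simp: leaves_def)
  ultimately show ?thesis by linarith
qed

text \<open>Count arcs: \<open>E\<close> holds the arcs leaving leaves, \<open>F\<close> those from
  \<open>H\<close> into \<open>T\<close>. Together with their converses they are disjoint families
  inside \<open>parcs G\<close>, whose size is at most \<open>2 * n\<close>.\<close>

lemma
  assumes U: "unicycle_graph G" and c: "arc_connected G" and S: "global_offensive_alliance G S"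
  defines "T \<equiv> (S - leaves G) \<union> support_vertices G"
  defines "H \<equiv> pverts G - leaves G - T"
  shows goa_card_rest: "card H \<le> card T"
    and goa_card_pverts: "card (pverts G) = card (leaves G) + card T + card H"
    and goa_card_rest_eq: "card H = card T \<Longrightarrow>
      (\<forall>v \<in> T. open_nbhd G v \<inter> T = {}) \<and> (\<forall>v \<in> H. vertex_degree G v = 2 \<and> open_nbhd G v \<subseteq> T)"
proof -
  note G = unicycle_graph_pair_graph[OF U]
  let ?L = "leaves G" and ?P = "support_vertices G" and ?N = "open_nbhd G"
  have d: "?P \<inter> ?L = {}" by (rule support_disjoint_leaves[OF U c])
  have TV: "T \<subseteq> pverts G"
    using goa_subset[OF S] support_vertices_subset[of G] by (auto simp: T_def)
  have finV: "finite (pverts G)" using G by (simp add: pair_graph_iff)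
  have fin: "finite ?L" "finite T" "finite H"
    using finV finite_subset[OF TV] finite_leaves[OF G] by (auto simp: H_def)
  have disj: "?L \<inter> T = {}" "?L \<inter> H = {}" "T \<inter> H = {}" using d by (auto simp: T_def H_def)
  have V: "pverts G = ?L \<union> T \<union> H" using TV leaves_subset[of G] by (auto simp: H_def)
  show cV: "card (pverts G) = card ?L + card T + card H"
    unfolding V using fin disj by (subst card_Un_disjoint; auto simp: card_Un_disjoint)
  have LN: "?N u \<subseteq> T" if "u \<in> ?L" for u
    using that G leaves_subset[of G]
    by (auto simp: T_def support_vertices_def open_nbhd_iff pair_graph_iff open_nbhd_def)
  have two: "2 \<le> card (?N h \<inter> T)" if h: "h \<in> H" for h
  proof -
    have h': "h \<in> pverts G" "h \<notin> ?L" "h \<notin> S" "h \<notin> ?P" using h by (auto simp: H_def T_def)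
    \<comment> \<open>Since \<open>h\<close> is not a support vertex, none of its neighbours in
      \<open>S\<close> is a leaf, and all of them remain in \<open>T\<close>.\<close>
    have "?N h \<inter> ?L = {}" using h' by (auto simp: support_vertices_def)
    then have "?N h \<inter> S \<subseteq> ?N h \<inter> T" by (auto simp: T_def)
    then have "card (?N h \<inter> S) \<le> card (?N h \<inter> T)"
      by (rule card_mono[rotated]) (simp add: finite_open_nbhd[OF G])
    then show ?thesis using goa_two_nbrs[OF G S h'(1-3)] by linarith
  qed
  define E where "E = Sigma ?L ?N"
  define F where "F = Sigma H (\<lambda>h. ?N h \<inter> T)"
  have finN: "finite (?N u)" for u by (rule finite_open_nbhd[OF G])
  have sub: "E \<subseteq> ?L \<times> T" "F \<subseteq> H \<times> T" using LN by (auto simp: E_def F_def)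
  have finEF: "finite E" "finite F" using sub fin finite_subset[OF sub(1)] finite_subset[OF sub(2)] by auto
  have cE: "card E = card ?L" unfolding E_def
    using fin finN by (subst card_SigmaI) (auto simp: leaves_def vertex_degree_def)
  have cF: "card F = (\<Sum>h \<in> H. card (?N h \<inter> T))" unfolding F_def
    using fin finN by (subst card_SigmaI) auto
  have "(\<Sum>h \<in> H. 2) \<le> (\<Sum>h \<in> H. card (?N h \<inter> T))" using two by (rule sum_mono)
  then have F2: "2 * card H \<le> card F" by (simp add: cF)
  have sub2: "E \<union> E\<inverse> \<union> (F \<union> F\<inverse>) \<subseteq> parcs G"
    using G by (auto simp: E_def F_def open_nbhd_iff pair_graph_iff)
  \<comment> \<open>Sources lie in \<open>?L\<close> or \<open>H\<close>, targets in
    \<open>T\<close>, and these three sets are disjoint, so no arc coincides with a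
    converse.\<close>
  have "card (E \<union> E\<inverse>) = 2 * card E" "card (F \<union> F\<inverse>) = 2 * card F"
    using sub disj finEF by (subst card_Un_disjoint; auto simp: card_inverse)+
  moreover have "(E \<union> E\<inverse>) \<inter> (F \<union> F\<inverse>) = {}" using sub disj by fast
  ultimately have cEF: "card (E \<union> E\<inverse> \<union> (F \<union> F\<inverse>)) = 2 * card ?L + 2 * card F"
    using finEF cE by (simp add: card_Un_disjoint)
  then have le: "2 * card ?L + 2 * card F \<le> card (parcs G)"
    using card_mono[OF finite_parcs[OF G] sub2] by simp
  have up: "card (parcs G) \<le> 2 * card (pverts G)" by (rule unicycle_card_parcs[OF U])
  show "card H \<le> card T" using le up F2 cV by linarith
  assume eq: "card H = card T"
  \<comment> \<open>With \<open>card H = card T\<close> the lower and upper bounds on the number of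
    arcs meet, so the counted arcs are all arcs of \<open>G\<close>.\<close>
  have F_eq: "card F = 2 * card H" and all: "card (parcs G) = 2 * card ?L + 2 * card F"
    using le up F2 cV eq by linarith+
  have arcs: "parcs G = E \<union> E\<inverse> \<union> (F \<union> F\<inverse>)"
    using card_subset_eq[OF finite_parcs[OF G] sub2] cEF all by simp
  have NT: "?N v \<subseteq> T" if "v \<in> H" for v
  proof
    fix u assume "u \<in> ?N v"
    then have "(v, u) \<in> E \<union> E\<inverse> \<union> (F \<union> F\<inverse>)" using open_nbhd_iff[OF G] arcs by blast
    then show "u \<in> T" using that sub disj by blast
  qed
  have "card (?N v \<inter> T) = 2" if v: "v \<in> H" for v
  proof (rule ccontr)
    assume "card (?N v \<inter> T) \<noteq> 2"
    \<comment> \<open>One vertex of \<open>H\<close> with more than two neighbours in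
      \<open>T\<close> would push \<open>card F\<close> above \<open>2 * card H\<close>.\<close>
    then have "(\<Sum>h \<in> H. 2) < (\<Sum>h \<in> H. card (?N h \<inter> T))"
      using two v fin(3) by (intro sum_strict_mono_ex1) (auto intro!: bexI[of _ v] simp: le_neq_implies_less)
    then show False using F_eq cF by simp
  qed
  then have "vertex_degree G v = 2" if "v \<in> H" for v
    using NT[OF that] that by (metis Int_absorb2 vertex_degree_def)
  moreover have "?N v \<inter> T = {}" if "v \<in> T" for v
  proof -
    have "(v, u) \<notin> E \<union> E\<inverse> \<union> (F \<union> F\<inverse>)" if "u \<in> T" for u
      using that \<open>v \<in> T\<close> sub disj by blast
    then show ?thesis using open_nbhd_iff[OF G] arcs by blast
  qed
  ultimately show "(\<forall>v \<in> T. ?N v \<inter> T = {}) \<and> (\<forall>v \<in> H. vertex_degree G v = 2 \<and> ?N v \<subseteq> T)"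
    using NT by blast
qed

text \<open>Written additively to avoid truncated subtraction. With \<open>H\<close> the vertices
  outside \<open>leaves G\<close> and \<open>?T\<close>, \<open>n - l + s\<close> is the sum of the
  sizes of \<open>?T\<close>, \<open>H\<close> and \<open>?P\<close>, each at most
  \<open>card ?T \<le> card S\<close>.\<close>

lemma goa_lower_bound:
  assumes U: "unicycle_graph G" and c: "arc_connected G" and S: "global_offensive_alliance G S"
  shows "card (pverts G) + card (support_vertices G) \<le> 3 * card S + card (leaves G)"
    and "card (pverts G) + card (support_vertices G) = 3 * card S + card (leaves G)
      \<Longrightarrow> subdivided_corona G"
proof -
  note G = unicycle_graph_pair_graph[OF U]
  let ?P = "support_vertices G" and ?T = "(S - leaves G) \<union> support_vertices G"
  have d: "?P \<inter> leaves G = {}" by (rule support_disjoint_leaves[OF U c])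
  have finT: "finite ?T"
    using finite_goa[OF G S] finite_support_vertices[OF G] by auto
  have PT: "card ?P \<le> card ?T" using finT by (intro card_mono) auto
  note b = goa_support_exchange[OF G S d] goa_card_rest[OF U c S] goa_card_pverts[OF U c S] PT
  show "card (pverts G) + card ?P \<le> 3 * card S + card (leaves G)" using b by linarith
  assume "card (pverts G) + card ?P = 3 * card S + card (leaves G)"
  \<comment> \<open>In the equality case all three summands attain their common bound; as
    \<open>?P\<close> is contained in \<open>?T\<close>, the two sets agree.\<close>
  then have e: "card ?P = card ?T" "card (pverts G - leaves G - ?T) = card ?T"
    using b by linarith+
  have T: "?T = ?P" using card_subset_eq[OF finT _ e(1)] by blast
  show "subdivided_corona G"
    using goa_card_rest_eq[OF U c S e(2)] b(3) e d unfolding T subdivided_corona_def by simp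
qed

text \<open>A vertex outside the support set has all its neighbours in it and at least one of them,
  so only the vertex itself counts against the alliance.\<close>

lemma subdivided_corona_goa:
  assumes G: "pair_graph G" and t: "subdivided_corona G"
  shows "global_offensive_alliance G (support_vertices G)"
proof -
  let ?P = "support_vertices G" and ?N = "open_nbhd G"
  have main: "(\<exists>u \<in> ?P. u \<in> ?N v) \<and> card (closed_nbhd G v - ?P) \<le> card (closed_nbhd G v \<inter> ?P)"
    if v: "v \<in> pverts G - ?P" for v
  proof -
    have NP: "?N v \<subseteq> ?P \<and> ?N v \<noteq> {}"
    proof (cases "v \<in> leaves G")
      case True
      then have "?N v \<noteq> {}" by (auto simp: leaves_def vertex_degree_def)
      moreover have "u \<in> ?P" if "u \<in> ?N v" for u
        using that True G by (auto simp: support_vertices_def open_nbhd_iff pair_graph_iff)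
      ultimately show ?thesis by blast
    next
      case False
      then have "vertex_degree G v = 2" "?N v \<subseteq> ?P"
        using t v by (auto simp: subdivided_corona_def)
      then show ?thesis by (auto simp: vertex_degree_def)
    qed
    then have "closed_nbhd G v - ?P = {v}" "closed_nbhd G v \<inter> ?P = ?N v"
      using v by (auto simp: closed_nbhd_def)
    moreover have "1 \<le> card (?N v)"
      using NP finite_open_nbhd[OF G, of v] by (simp add: Suc_le_eq card_gt_0_iff)
    ultimately show ?thesis using NP by auto
  qed
  then show ?thesis
    using support_vertices_subset[of G] by (auto simp: global_offensive_alliance_def dominating_set_def)
qed

lemma global_offensive_alliance_number_eq_iff:
  assumes U: "unicycle_graph G" and c: "arc_connected G"
  shows "card (pverts G) + card (support_vertices G) =
      3 * global_offensive_alliance_number G + card (leaves G) \<longleftrightarrow> subdivided_corona G"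
proof -
  note G = unicycle_graph_pair_graph[OF U]
  let ?A = "{S. global_offensive_alliance G S}"
  have "finite (Pow (pverts G))" using G by (simp add: pair_graph_iff)
  then have "finite ?A" by (rule rev_finite_subset) (auto dest: goa_subset)
  then have fin: "finite (card ` ?A)" by simp
  \<comment> \<open>The whole vertex set is an alliance, so the minimum is taken over a nonempty set
    and is attained.\<close>
  have "pverts G \<in> ?A" by (auto simp: global_offensive_alliance_def dominating_set_def)
  then obtain S where S: "global_offensive_alliance G S" "global_offensive_alliance_number G = card S"
    using Min_in[OF fin] unfolding global_offensive_alliance_number_def by blast
  have "global_offensive_alliance_number G \<le> card (support_vertices G)" if "subdivided_corona G"
    unfolding global_offensive_alliance_number_def
    using subdivided_corona_goa[OF G that] by (intro Min_le fin) auto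
  moreover have "card (pverts G) = card (leaves G) + 2 * card (support_vertices G)"
    if "subdivided_corona G" using that by (simp add: subdivided_corona_def)
  \<comment> \<open>Forwards, the equality case of the bound is applied to a minimum alliance.
    Backwards, the support set gives the upper bound, and the cardinality equation makes it meet the
    lower bound.\<close>
  ultimately show ?thesis
    using goa_lower_bound[OF U c S(1)] S(2) by force
qed

subsection \<open>The family\<close>

text \<open>For \<open>k = 2 * m\<close>, the cycle vertices of odd index are the support vertices
  (\<open>X\<close>), those of even index the subdivision vertices (\<open>Z\<close>), and the
  pendent vertices the leaves (\<open>Y\<close>); each set has \<open>m\<close> elements. Most of
  the work is computing neighbourhoods.\<close>

lemma subdivided_corona_pendent_even_cycle:
  assumes k: "even k" "4 \<le> k" and inj: "inj_on x {1..k}" "inj_on y {1..k div 2}"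
    and disj: "x ` {1..k} \<inter> y ` {1..k div 2} = {}"
    and G: "pair_graph (pendent_even_cycle k x y)"
  shows "subdivided_corona (pendent_even_cycle k x y)"
proof -
  obtain m where m: "k = 2 * m" "2 \<le> m" using k by auto
  let ?G = "pendent_even_cycle k x y"
  let ?I = "{1..m}"
  define X where "X = (\<lambda>i. x (2 * i - 1)) ` ?I"
  define Z where "Z = (\<lambda>i. x (2 * i)) ` ?I"
  define Y where "Y = y ` ?I"
  note sets = X_def Z_def Y_def
  have xx: "x i = x j \<longleftrightarrow> i = j" if "1 \<le> i" "i \<le> 2 * m" "1 \<le> j" "j \<le> 2 * m" for i j
    using inj_on_eq_iff[OF inj(1)] that m by simp
  have yy: "y i = y j \<longleftrightarrow> i = j" if "1 \<le> i" "i \<le> m" "1 \<le> j" "j \<le> m" for i j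
    using inj_on_eq_iff[OF inj(2)] that m by simp
  have xy: "x i \<noteq> y j" "y j \<noteq> x i" if "1 \<le> i" "i \<le> 2 * m" "1 \<le> j" "j \<le> m" for i j
  proof -
    have "x i \<in> x ` {1..k}" "y j \<in> y ` {1..k div 2}" using that m by auto
    then show "x i \<noteq> y j" "y j \<noteq> x i" using disj by (metis disjoint_iff)+
  qed
  \<comment> \<open>One orientation of the edges: \<open>adj_x\<close> below lists the
    out-neighbours of a cycle vertex, \<open>x_adj\<close> its in-neighbours.\<close>
  define adj where "adj u w \<longleftrightarrow> (\<exists>i. 1 \<le> i \<and> i < 2 * m \<and> u = x i \<and> w = x (Suc i)) \<or>
      (u = x (2 * m) \<and> w = x 1) \<or> (\<exists>i. 1 \<le> i \<and> i \<le> m \<and> u = x (2 * i - 1) \<and> w = y i)" for u w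
  have N: "u \<in> open_nbhd ?G w \<longleftrightarrow> adj w u \<or> adj u w" for u w
    unfolding open_nbhd_iff[OF G] by (auto simp: pendent_even_cycle_def sym_arcs_def adj_def m)
  have Ny: "open_nbhd ?G (y i) = {x (2 * i - 1)}" if "i \<in> ?I" for i
    using that m(2) by (auto simp: N adj_def xx yy xy)
  have adj_x: "adj (x j) u \<longleftrightarrow> j < 2 * m \<and> u = x (Suc j) \<or> j = 2 * m \<and> u = x 1 \<or>
      (\<exists>i. 1 \<le> i \<and> i \<le> m \<and> j = 2 * i - 1 \<and> u = y i)" if j: "1 \<le> j" "j \<le> 2 * m" for j u
  proof -
    have "(\<exists>i. 1 \<le> i \<and> i < 2 * m \<and> x j = x i \<and> u = x (Suc i)) \<longleftrightarrow> j < 2 * m \<and> u = x (Suc j)"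
      using xx[OF j] j by (metis less_imp_le)
    moreover have "x j = x (2 * m) \<longleftrightarrow> j = 2 * m" using xx[OF j, of "2 * m"] m by simp
    moreover have "x j = x (2 * i - 1) \<longleftrightarrow> j = 2 * i - 1" if "1 \<le> i" "i \<le> m" for i
      using xx[OF j, of "2 * i - 1"] that by simp
    ultimately show ?thesis unfolding adj_def by blast
  qed
  have x_adj: "adj u (x j) \<longleftrightarrow> (if j = 1 then u = x (2 * m) else u = x (j - 1))"
    if j: "1 \<le> j" "j \<le> 2 * m" for j u
  proof -
    have "x j = x (Suc i) \<longleftrightarrow> j = Suc i" if "1 \<le> i" "i < 2 * m" for i
      using xx[OF j, of "Suc i"] that by simp
    then have "(\<exists>i. 1 \<le> i \<and> i < 2 * m \<and> u = x i \<and> x j = x (Suc i)) \<longleftrightarrow> j \<noteq> 1 \<and> u = x (j - 1)"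
      using j by (cases j) (auto simp: Suc_le_eq)
    moreover have "x j = x 1 \<longleftrightarrow> j = 1" using xx[OF j, of 1] m by simp
    moreover have "x j \<noteq> y i" if "1 \<le> i" "i \<le> m" for i using xy j that by simp
    ultimately show ?thesis unfolding adj_def by auto
  qed
  have Nz: "open_nbhd ?G (x (2 * i)) = {x (2 * i - 1), x (if i = m then 1 else Suc (2 * i))}"
    if "i \<in> ?I" for i
  proof -
    have "2 * i \<noteq> 2 * i' - 1" if "1 \<le> i'" for i' :: nat using that by presburger
    then have "adj (x (2 * i)) u \<longleftrightarrow> u = x (if i = m then 1 else Suc (2 * i))" for u
      using that adj_x[of "2 * i" u] by auto
    moreover have "adj u (x (2 * i)) \<longleftrightarrow> u = x (2 * i - 1)" for u
      using that x_adj[of "2 * i" u] by auto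
    ultimately show ?thesis by (auto simp: N)
  qed
  \<comment> \<open>For \<open>i = 1\<close> the index \<open>2 * i - 2\<close> would be 0, which
    lies outside the cycle; the predecessor of \<open>x 1\<close> is
    \<open>x (2 * m)\<close>.\<close>
  have Nx: "open_nbhd ?G (x (2 * i - 1)) =
      {x (2 * i), x (if i = 1 then 2 * m else 2 * i - 2), y i}" if i: "i \<in> ?I" for i
  proof -
    have b: "1 \<le> 2 * i - 1" "2 * i - 1 \<le> 2 * m" and e: "2 * i - 1 < 2 * m" "2 * i - 1 \<noteq> 2 * m"
      "Suc (2 * i - 1) = 2 * i" "2 * i - 1 = 1 \<longleftrightarrow> i = 1" "2 * i - 1 - 1 = 2 * i - 2"
      using i by auto
    have "2 * i - 1 = 2 * i' - 1 \<longleftrightarrow> i' = i" if "1 \<le> i'" for i' using that i by auto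
    then have "(\<exists>i'. 1 \<le> i' \<and> i' \<le> m \<and> 2 * i - 1 = 2 * i' - 1 \<and> u = y i') \<longleftrightarrow> u = y i" for u
      using i by (metis atLeastAtMost_iff)
    then have "adj (x (2 * i - 1)) u \<longleftrightarrow> u = x (2 * i) \<or> u = y i" for u
      unfolding adj_x[OF b] using e by simp
    moreover have "adj u (x (2 * i - 1)) \<longleftrightarrow> u = x (if i = 1 then 2 * m else 2 * i - 2)" for u
      unfolding x_adj[OF b] e by simp
    ultimately show ?thesis by (auto simp: N)
  qed
  have V: "pverts ?G = X \<union> Z \<union> Y"
  proof -
    have "j \<in> (\<lambda>i. 2 * i - 1) ` ?I \<union> (\<lambda>i. 2 * i) ` ?I" if "j \<in> {1..2 * m}" for j
    proof (cases "even j")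
      case True
      then show ?thesis using that by (auto elim!: evenE)
    next
      case False
      then have "j = 2 * Suc (j div 2) - 1" by presburger
      moreover have "Suc (j div 2) \<in> ?I" using that False by simp presburger
      ultimately show ?thesis by blast
    qed
    moreover have "(\<lambda>i. 2 * i - 1) ` ?I \<union> (\<lambda>i. 2 * i) ` ?I \<subseteq> {1..2 * m}" by auto
    ultimately have "{1..2 * m} = (\<lambda>i. 2 * i - 1) ` ?I \<union> (\<lambda>i. 2 * i) ` ?I" by blast
    then show ?thesis by (simp add: sets pendent_even_cycle_def m image_Un image_image)
  qed
  have dy: "vertex_degree ?G (y i) = 1" if "i \<in> ?I" for i
    using that by (simp add: vertex_degree_def Ny)
  have dz: "vertex_degree ?G (x (2 * i)) = 2" if "i \<in> ?I" for i
    using that m(2) by (auto simp: vertex_degree_def Nz xx)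
  have dx: "vertex_degree ?G (x (2 * i - 1)) \<noteq> 1" if i: "i \<in> ?I" for i
  proof -
    have "x (2 * i) \<noteq> y i" using i xy by simp
    moreover have "x (2 * i) \<in> open_nbhd ?G (x (2 * i - 1))" "y i \<in> open_nbhd ?G (x (2 * i - 1))"
      unfolding Nx[OF i] by simp_all
    ultimately show ?thesis unfolding vertex_degree_def by (metis card_1_singletonE singletonD)
  qed
  have dZ: "vertex_degree ?G v = 2" if "v \<in> Z" for v
    using that dz unfolding sets by blast
  have ZX: "Z \<inter> X = {}"
  proof -
    have "x (2 * i) \<noteq> x (2 * j - 1)" if "i \<in> ?I" "j \<in> ?I" for i j
    proof -
      have "2 * i \<noteq> 2 * j - 1" using that by simp presburger
      moreover have "1 \<le> 2 * i" "2 * i \<le> 2 * m" "1 \<le> 2 * j - 1" "2 * j - 1 \<le> 2 * m"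
        using that by auto
      ultimately show ?thesis using xx by blast
    qed
    then show ?thesis unfolding sets by blast
  qed
  have XY: "X \<inter> Y = {}" "Z \<inter> Y = {}" by (auto simp: sets xy)
  have NY: "open_nbhd ?G v \<subseteq> X" if "v \<in> Y" for v using that by (auto simp: sets Ny)
  have NZ: "open_nbhd ?G v \<subseteq> X" if v: "v \<in> Z" for v
  proof -
    obtain i where i: "i \<in> ?I" "v = x (2 * i)" using v unfolding sets by blast
    have "x 1 \<in> X" unfolding sets using m(2) by (intro image_eqI[of _ _ 1]) auto
    moreover have "x (Suc (2 * i)) \<in> X" if "i \<noteq> m"
      unfolding sets using i(1) that by (intro image_eqI[of _ _ "Suc i"]) auto
    moreover have "x (2 * i - 1) \<in> X" unfolding sets using i(1) by blast
    ultimately show ?thesis using Nz[OF i(1)] unfolding i(2) by auto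
  qed
  have NX: "open_nbhd ?G v \<subseteq> Z \<union> Y \<and> open_nbhd ?G v \<inter> Y \<noteq> {}" if v: "v \<in> X" for v
  proof -
    obtain i where i: "i \<in> ?I" "v = x (2 * i - 1)" using v unfolding sets by blast
    have "x (2 * m) \<in> Z" unfolding sets using m(2) by (intro imageI) simp
    moreover have "x (2 * i - 2) \<in> Z" if "i \<noteq> 1"
      unfolding sets using i(1) that by (intro image_eqI[of _ _ "i - 1"]) (auto simp: diff_mult_distrib2)
    moreover have "x (2 * i) \<in> Z" "y i \<in> Y" unfolding sets using i(1) by blast+
    ultimately show ?thesis using Nx[OF i(1)] unfolding i(2) by auto
  qed
  have "vertex_degree ?G v \<noteq> 1" if v: "v \<in> X \<union> Z" for v
  proof -
    consider i where "i \<in> ?I" "v = x (2 * i - 1)" | i where "i \<in> ?I" "v = x (2 * i)" using v unfolding sets by blast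
    then show ?thesis using dx dz by cases simp_all
  qed
  moreover have "vertex_degree ?G v = 1" if "v \<in> Y" for v using that dy unfolding sets by blast
  ultimately have L: "leaves ?G = Y" unfolding leaves_def V by blast
  have S: "support_vertices ?G = X"
  proof (intro set_eqI iffI)
    fix v assume "v \<in> support_vertices ?G"
    then obtain u where u: "u \<in> Y" "u \<in> open_nbhd ?G v" and v: "v \<in> pverts ?G"
      unfolding support_vertices_def L by blast
    have "u \<notin> X" using u(1) XY(1) by blast
    then have "v \<notin> Z" "v \<notin> Y" using NZ NY u(2) by blast+
    then show "v \<in> X" using v unfolding V by simp
  next
    fix v assume v: "v \<in> X"
    then obtain u where "u \<in> Y" "u \<in> open_nbhd ?G v" using NX[OF v] by blast
    then show "v \<in> support_vertices ?G" unfolding support_vertices_def L V using v by simp blast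
  qed
  have H: "pverts ?G - leaves ?G - support_vertices ?G = Z"
    unfolding L S V using XY ZX by fast
  have XX: "open_nbhd ?G v \<inter> X = {}" if "v \<in> X" for v
    using NX[OF that] XY ZX by (simp only: disjoint_iff) (metis UnE subsetD)
  have card: "card X = m" "card Y = m"
    unfolding sets by (subst card_image; auto simp: inj_on_def xx yy)+
  have "card (pverts ?G) = card (x ` {1..k}) + card (y ` {1..k div 2})"
    using disj by (simp add: pendent_even_cycle_def card_Un_disjoint)
  also have "\<dots> = 3 * m" using inj m by (simp add: card_image)
  finally have "card (pverts ?G) = 3 * m" .
  then show ?thesis
    unfolding subdivided_corona_def H unfolding L S using card XY XX NZ dZ by simp
qed

text \<open>Rule induction. The invariant contains the disjointness of support vertices and leaves,
  which supplies the side condition \<open>v \<notin> leaves G\<close> of the two operation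
  lemmas.\<close>

lemma family_G_structure:
  assumes "G \<in> family_G"
  shows "unicycle_graph G \<and> subdivided_corona G"
  using assms
proof induct
  case (base k x y)
  then show ?case
    by (simp add: subdivided_corona_pendent_even_cycle unicycle_graph_pair_graph)
next
  case (O1 G v a)
  then have G: "pair_graph G" and t: "subdivided_corona G"
    by (simp_all add: unicycle_graph_pair_graph)
  have "v \<notin> leaves G" using t O1(3) by (auto simp: subdivided_corona_def)
  then show ?case using subdivided_corona_op1[OF G O1(3)] O1(4,5) t by simp
next
  case (O2 G v a b c)
  then have G: "pair_graph G" and t: "subdivided_corona G"
    by (simp_all add: unicycle_graph_pair_graph)
  have "v \<notin> leaves G" using t O2(3) by (auto simp: subdivided_corona_def)
  then show ?case using subdivided_corona_op2[OF G O2(3) _ O2(4,5)] O2(6) t by simp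
qed

section \<open>Reducing extremal graphs to a starting graph\<close>

lemma op1_delete_vertex:
  assumes G: "pair_graph G" and a: "a \<in> pverts G" "open_nbhd G a = {v}"
  shows "op1 (delete_vertex G a) v a = G"
proof -
  have "(a, u) \<in> parcs G \<longleftrightarrow> u = v" "(u, a) \<in> parcs G \<longleftrightarrow> u = v" for u
    using a(2) G by (auto simp: open_nbhd_iff[OF G, symmetric] pair_graph_iff)
  then have "parcs (op1 (delete_vertex G a) v a) = parcs G"
    by (auto simp: op1_def delete_vertex_def sym_arcs_def)
  moreover have "pverts (op1 (delete_vertex G a) v a) = pverts G"
    using a(1) by (auto simp: op1_def delete_vertex_def)
  ultimately show ?thesis by (intro pair_pre_digraph.equality) (auto simp: op1_def)
qed

lemma open_nbhd_delete_vertex: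
  "u \<noteq> a \<Longrightarrow> open_nbhd (delete_vertex G a) u = open_nbhd G u - {a}"
  by (auto simp: open_nbhd_def delete_vertex_def)

text \<open>Serves to start a cycle at a support vertex; the value at index \<open>k\<close> closes
  the sequence at its new first vertex \<open>x 1\<close>.\<close>

lemma cyclic_seq_rotate:
  assumes x: "cyclic_seq G x k"
  shows "cyclic_seq G (\<lambda>i. if i = k then x 1 else x (Suc i)) k"
proof -
  have "inj_on (\<lambda>i. if i = k then x 1 else x (Suc i)) {..<k}"
  proof (rule inj_onI)
    fix i j assume "i \<in> {..<k}" "j \<in> {..<k}"
      "(if i = k then x 1 else x (Suc i)) = (if j = k then x 1 else x (Suc j))"
    then show "i = j"
      using x inj_onD[of x "{..<k}" "if Suc i = k then 0 else Suc i" "if Suc j = k then 0 else Suc j"]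
      by (cases "Suc i = k"; cases "Suc j = k") (auto simp: cyclic_seq_def)
  qed
  moreover have "((if i = k then x 1 else x (Suc i)), (if Suc i = k then x 1 else x (Suc (Suc i)))) \<in> parcs G"
    if "i < k" for i
    using x that by (cases "Suc i = k") (auto simp: cyclic_seq_def)
  ultimately show ?thesis using x by (auto simp: cyclic_seq_def)
qed

text \<open>The irreducible case. Support and subdivision vertices alternate on the cycle, and every
  cycle vertex has only its two cycle neighbours besides leaves. Hence the cycle with its leaves is
  closed, and by connectedness it is the whole graph.\<close>

lemma subdivided_corona_cycle:
  assumes U: "unicycle_graph G" and c: "arc_connected G" and t: "subdivided_corona G"
    and one: "\<And>v. v \<in> support_vertices G \<Longrightarrow> \<exists>u. open_nbhd G v \<inter> leaves G = {u}"
    and two: "\<And>v. v \<in> support_vertices G \<Longrightarrow> card (open_nbhd G v - leaves G) = 2"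
  shows "G \<in> family_G"
proof -
  note G = unicycle_graph_pair_graph[OF U]
  let ?L = "leaves G" and ?S = "support_vertices G" and ?N = "open_nbhd G"
  have SL: "?S \<inter> ?L = {}" and indep: "\<And>v. v \<in> ?S \<Longrightarrow> ?N v \<inter> ?S = {}"
    and rest: "\<And>v. v \<in> pverts G \<Longrightarrow> v \<notin> ?L \<Longrightarrow> v \<notin> ?S \<Longrightarrow> card (?N v) = 2 \<and> ?N v \<subseteq> ?S"
    using t by (auto simp: subdivided_corona_def vertex_degree_def)
  have nonleaf: "x i \<notin> ?L" "x i \<in> pverts G" if "cyclic_seq G x k" "i \<le> k" for x k i
    using cyclic_seq_degree[OF that(1) G that(2)] by (auto simp: leaves_def)
  \<comment> \<open>Support vertices are pairwise nonadjacent, and the other nonleaves have only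
    support vertices as neighbours.\<close>
  have alt: "x (Suc i) \<in> ?S \<longleftrightarrow> x i \<notin> ?S" if x: "cyclic_seq G x k" and i: "i < k" for x k i
  proof -
    have "x (Suc i) \<in> ?N (x i)" using x i by (simp add: cyclic_seq_def open_nbhd_iff[OF G])
    then show ?thesis using indep[of "x i"] rest[of "x i"] nonleaf[OF x, of i] i by auto
  qed
  obtain x k where x: "cyclic_seq G x k" and x0: "x 0 \<in> ?S"
  proof -
    obtain x k where x: "cyclic_seq G x k" using U by (rule unicycle_obtains_cyclic_seq)
    then have "0 < k" by (auto simp: cyclic_seq_def)
    show thesis
    proof (cases "x 0 \<in> ?S")
      case True
      then show thesis using that x by blast
    next
      case False
      then have "x 1 \<in> ?S" using alt[OF x \<open>0 < k\<close>] by simp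
      then show thesis using that[OF cyclic_seq_rotate[OF x]] \<open>0 < k\<close> by simp
    qed
  qed
  have k: "3 \<le> k" and inj: "inj_on x {..<k}" and xk: "x k = x 0"
    and arc: "\<And>i. i < k \<Longrightarrow> (x i, x (Suc i)) \<in> parcs G"
    using x by (auto simp: cyclic_seq_def)
  have xS: "x i \<in> ?S \<longleftrightarrow> even i" if "i \<le> k" for i
    using that x0 alt[OF x] by (induct i) auto
  have "even k" using xS[of k] xS[of 0] xk by simp
  then have k4: "4 \<le> k" using k by presburger
  let ?R = "x ` {..<k}"
  \<comment> \<open>Predecessor and successor are two nonleaf neighbours, and there are exactly two:
    by \<open>two\<close> at support vertices, by degree two elsewhere.\<close>
  have ring: "\<exists>j<k. ?N (x i) - ?L = {x (Suc i), x j} \<and> x i = x (Suc j)" if i: "i < k" for i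
  proof -
    obtain j where j: "j < k" "x j \<noteq> x (Suc i)" "{x (Suc i), x j} \<subseteq> ?N (x i)"
      "Suc j = i \<or> i = 0 \<and> Suc j = k"
      using cyclic_seq_nbrs[OF x G i] by blast
    have "card (?N (x i) - ?L) = 2"
    proof (cases "x i \<in> ?S")
      case False
      then have "card (?N (x i)) = 2" "?N (x i) \<subseteq> ?S" using rest nonleaf[OF x] i by simp_all
      moreover have "?N (x i) - ?L = ?N (x i)" using \<open>?N (x i) \<subseteq> ?S\<close> SL by blast
      ultimately show ?thesis by simp
    qed (rule two)
    moreover have "{x (Suc i), x j} \<subseteq> ?N (x i) - ?L"
      using j(1,3) nonleaf[OF x] i by simp
    moreover have "card {x (Suc i), x j} = 2" using j(2) by auto
    moreover have "finite (?N (x i) - ?L)" using finite_open_nbhd[OF G] by simp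
    ultimately have "{x (Suc i), x j} = ?N (x i) - ?L" by (metis card_subset_eq)
    then show ?thesis using j(1,4) xk by metis
  qed
  have xR: "x i \<in> ?R" if "i \<le> k" for i
    using that xk k by (cases "i = k") auto
  let ?A = "?R \<union> {u \<in> ?L. ?N u \<subseteq> ?R}"
  have V: "pverts G = ?A"
  proof -
    have "w \<in> ?A" if u: "u \<in> ?A" and uw: "(u, w) \<in> parcs G" for u w
    proof (cases "u \<in> ?R")
      case True
      then obtain i where i: "i < k" "u = x i" by blast
      have wN: "w \<in> ?N (x i)" using uw i by (simp add: open_nbhd_iff[OF G])
      obtain j where "j < k" "?N (x i) - ?L = {x (Suc i), x j}" using ring[OF i(1)] by blast
      then have "w \<in> {x (Suc i), x j}" if "w \<notin> ?L" using that wN by blast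
      then have "w \<in> ?R" if "w \<notin> ?L"
        using that xR[of "Suc i"] xR[of j] i(1) \<open>j < k\<close> by (metis Suc_leI insertE less_imp_le singletonD)
      moreover have "?N w = {x i}" if "w \<in> ?L" using leaf_nbhd[OF G that wN] .
      ultimately show ?thesis using i by auto
    next
      case False
      then show ?thesis using u uw by (auto simp: open_nbhd_iff[OF G, symmetric])
    qed
    moreover have "?A \<subseteq> pverts G" using nonleaf(2)[OF x] leaves_subset[of G] by auto
    moreover have "?A \<noteq> {}" using xR[of 0] by blast
    ultimately show ?thesis using c unfolding arc_connected_def by blast
  qed
  obtain f where f: "\<And>v. v \<in> ?S \<Longrightarrow> ?N v \<inter> ?L = {f v}" using one by metis
  have fL: "f v \<in> ?L" "f v \<in> ?N v" if "v \<in> ?S" for v using f[OF that] by blast+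
  have Nf: "?N (f v) = {v}" if "v \<in> ?S" for v using leaf_nbhd[OF G] fL that by blast
  \<comment> \<open>Shift from indices starting at 0 to those of \<open>pendent_even_cycle\<close>
    starting at 1: the support vertices at even positions of \<open>x\<close> move to the odd
    positions of \<open>X\<close>, and \<open>y i\<close> is the unique leaf at
    \<open>X (2 * i - 1)\<close>.\<close>
  define X where "X i = x (i - 1)" for i
  define y where "y i = f (x (2 * i - 2))" for i
  let ?I = "{1..k div 2}"
  have evS: "x (2 * i - 2) \<in> ?S" "2 * i - 2 < k" if "i \<in> ?I" for i
    using that xS[of "2 * i - 2"] \<open>even k\<close> by auto
  have XR: "X ` {1..k} = ?R"
    unfolding image_Suc_lessThan[symmetric] image_image by (simp add: X_def)
  have leaf: "\<exists>i \<in> ?I. u = y i" if u: "u \<in> ?L" for u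
  proof -
    have "u \<in> pverts G" using u leaves_subset[of G] by blast
    moreover have "u \<notin> ?R" using u nonleaf(1)[OF x] by auto
    ultimately have "?N u \<subseteq> ?R" unfolding V by blast
    moreover have "?N u \<noteq> {}" using u by (auto simp: leaves_def vertex_degree_def)
    ultimately obtain j where j: "j < k" "x j \<in> ?N u" by blast
    then have uN: "u \<in> ?N (x j)" using G by (auto simp: open_nbhd_iff pair_graph_iff)
    then have "x j \<in> ?S"
      using u nonleaf(2)[OF x, of j] j by (auto simp: support_vertices_def)
    then have "even j" "u = f (x j)" using xS[of j] j f[of "x j"] u uN by auto
    then have "u = y (Suc (j div 2))" by (simp add: y_def)
    moreover have "Suc (j div 2) \<in> ?I" using j \<open>even j\<close> \<open>even k\<close> by auto
    ultimately show ?thesis by blast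
  qed
  have L: "y ` ?I = ?L" using leaf fL(1) evS by (auto simp: y_def)
  have disj: "?R \<inter> ?L = {}" using nonleaf(1)[OF x] by auto
  have injX: "inj_on X {1..k}"
  proof (rule inj_onI)
    fix i j assume ij: "i \<in> {1..k}" "j \<in> {1..k}" "X i = X j"
    then have "i - 1 < k" "j - 1 < k" "x (i - 1) = x (j - 1)" by (auto simp: X_def)
    then have "i - 1 = j - 1" using inj_onD[OF inj] by blast
    then show "i = j" using ij(1,2) by auto
  qed
  have injy: "inj_on y ?I"
  proof (rule inj_onI)
    fix i j assume ij: "i \<in> ?I" "j \<in> ?I" "y i = y j"
    then have "x (2 * i - 2) = x (2 * j - 2)"
      using Nf evS by (metis singleton_inject y_def)
    then have "2 * i - 2 = 2 * j - 2" using inj_onD[OF inj] evS ij by blast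
    then show "i = j" using ij by auto
  qed
  \<comment> \<open>The oriented edges of \<open>pendent_even_cycle k X y\<close>; it remains to
    match their symmetric closure with the arcs of \<open>G\<close>.\<close>
  define E where "E = {(X i, X (i + 1)) | i. i \<in> {1..<k}} \<union> {(X k, X 1)}
          \<union> {(X (2 * i - 1), y i) | i. i \<in> ?I}"
  have E1: "(x i, x (Suc i)) \<in> E" if "i < k" for i
  proof (cases "Suc i = k")
    case True
    then show ?thesis using xk by (auto simp: E_def X_def)
  next
    case False
    then have "(x i, x (Suc i)) = (X (Suc i), X (Suc i + 1))" "Suc i \<in> {1..<k}"
      using that by (auto simp: X_def)
    then show ?thesis unfolding E_def by blast
  qed
  have E2: "(x (2 * i - 2), y i) \<in> E" if "i \<in> ?I" for i
  proof -
    have "(x (2 * i - 2), y i) = (X (2 * i - 1), y i)" by (simp add: X_def numeral_2_eq_2)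
    then show ?thesis unfolding E_def using that by blast
  qed
  have "parcs G = sym_arcs E"
  proof (intro set_eqI iffI)
    fix e assume e: "e \<in> parcs G"
    obtain u w where uw: "e = (u, w)" by (cases e)
    have arcs: "(u, w) \<in> parcs G" "(w, u) \<in> parcs G" using e uw G by (auto simp: pair_graph_iff)
    have leaf_arc: "(b, a) \<in> E" if "a \<in> ?L" "(a, b) \<in> parcs G" for a b
    proof -
      obtain i where i: "i \<in> ?I" "a = y i" using leaf[OF \<open>a \<in> ?L\<close>] by blast
      then have "b = x (2 * i - 2)"
        using Nf[OF evS(1)[OF i(1)]] that(2) by (auto simp: y_def open_nbhd_iff[OF G, symmetric])
      then show ?thesis using E2[OF i(1)] i(2) by simp
    qed
    have "u \<in> pverts G" using arcs(1) G by (auto simp: pair_graph_iff)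
    then have "u \<in> ?R \<or> u \<in> ?L" unfolding V by blast
    then consider "u \<in> ?L" | "w \<in> ?L" | "u \<in> ?R" "w \<notin> ?L" by blast
    then show "e \<in> sym_arcs E"
    proof cases
      case 3
      then obtain i where i: "i < k" "u = x i" by blast
      obtain j where j: "j < k" "?N (x i) - ?L = {x (Suc i), x j}" "x i = x (Suc j)"
        using ring[OF i(1)] by blast
      have "w \<in> ?N (x i) - ?L" using arcs(1) 3 i by (simp add: open_nbhd_iff[OF G])
      then have "w = x (Suc i) \<or> w = x j" using j(2) by blast
      then show ?thesis using E1[OF i(1)] E1[OF j(1)] i(2) j(3) by (auto simp: sym_arcs_def uw)
    qed (use leaf_arc arcs in \<open>auto simp: sym_arcs_def uw\<close>)
  next
    fix e assume "e \<in> sym_arcs E"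
    moreover have "(u, w) \<in> parcs G" if "(u, w) \<in> E" for u w
    proof -
      consider i where "i \<in> {1..<k}" "u = X i" "w = X (i + 1)" | "u = X k" "w = X 1"
        | i where "i \<in> ?I" "u = X (2 * i - 1)" "w = y i"
        using \<open>(u, w) \<in> E\<close> unfolding E_def by blast
      then show ?thesis
      proof cases
        case (1 i)
        then show ?thesis using arc[of "i - 1"] by (auto simp: X_def)
      next
        case 2
        then show ?thesis using arc[of "k - 1"] k xk by (auto simp: X_def)
      next
        case (3 i)
        then have "u = x (2 * i - 2)" by (simp add: X_def numeral_2_eq_2)
        then show ?thesis using fL(2)[OF evS(1)[OF 3(1)]] 3 by (simp add: y_def open_nbhd_iff[OF G])
      qed
    qed
    ultimately show "e \<in> parcs G"
      using G by (cases e) (auto simp: sym_arcs_def pair_graph_iff)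
  qed
  moreover have "pverts G = X ` {1..k} \<union> y ` ?I"
  proof (intro subset_antisym)
    show "pverts G \<subseteq> X ` {1..k} \<union> y ` ?I" unfolding XR L V by blast
    show "X ` {1..k} \<union> y ` ?I \<subseteq> pverts G"
      unfolding XR L using nonleaf(2)[OF x] leaves_subset[of G] by auto
  qed
  ultimately have eq: "G = pendent_even_cycle k X y"
    unfolding pendent_even_cycle_def E_def by (intro pair_pre_digraph.equality) auto
  have "unicycle_graph (pendent_even_cycle k X y)" using U by (simp only: eq[symmetric])
  moreover have "X ` {1..k} \<inter> y ` ?I = {}" unfolding XR L by (rule disj)
  ultimately have "pendent_even_cycle k X y \<in> family_G"
    using family_G.base[OF \<open>even k\<close> k4 injX injy] by blast
  then show ?thesis by (simp only: eq[symmetric])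
qed

text \<open>Double counting of the edges between \<open>?S\<close> and \<open>H\<close>: each vertex
  of \<open>H\<close> lies on two of them and \<open>card H = card ?S\<close>, so the average over
  \<open>?S\<close> is two. As two is also the minimum, it is attained everywhere.\<close>

lemma card_nonleaf_nbrs_eq_2:
  assumes G: "pair_graph G" and t: "subdivided_corona G"
    and ge: "\<And>v. v \<in> support_vertices G \<Longrightarrow> 2 \<le> card (open_nbhd G v - leaves G)"
    and v: "v \<in> support_vertices G"
  shows "card (open_nbhd G v - leaves G) = 2"
proof (rule ccontr)
  assume ne: "card (open_nbhd G v - leaves G) \<noteq> 2"
  let ?L = "leaves G" and ?S = "support_vertices G" and ?N = "open_nbhd G"
  define H where "H = pverts G - ?L - ?S"
  have SL: "?S \<inter> ?L = {}" and indep: "\<And>v. v \<in> ?S \<Longrightarrow> ?N v \<inter> ?S = {}"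
    and rest: "\<And>h. h \<in> H \<Longrightarrow> card (?N h) = 2 \<and> ?N h \<subseteq> ?S"
    and n: "card (pverts G) = card ?L + 2 * card ?S"
    using t by (auto simp: subdivided_corona_def vertex_degree_def H_def)
  have finV: "finite (pverts G)" using G by (simp add: pair_graph_iff)
  have fin: "finite ?S" "finite ?L" "finite H"
    using finV finite_support_vertices[OF G] finite_leaves[OF G] by (auto simp: H_def)
  have "H = pverts G - (?L \<union> ?S)" by (auto simp: H_def)
  moreover have "card (?L \<union> ?S) = card ?L + card ?S" using fin SL by (intro card_Un_disjoint) auto
  ultimately have cH: "card H = card ?S"
    using n fin leaves_subset[of G] support_vertices_subset[of G] by (simp add: card_Diff_subset)
  have finN: "finite (?N u)" for u by (rule finite_open_nbhd[OF G])
  \<comment> \<open>Nonleaf neighbours of support vertices lie in \<open>H\<close>, and all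
    neighbours of \<open>H\<close> lie in \<open>?S\<close>, so both sides list the same
    edges.\<close>
  have "(SIGMA u:?S. ?N u - ?L)\<inverse> = (SIGMA h:H. ?N h)"
  proof -
    have "u \<in> ?S \<and> h \<in> ?N u - ?L \<longleftrightarrow> h \<in> H \<and> u \<in> ?N h" for u h
    proof -
      have sym: "u \<in> ?N h \<longleftrightarrow> h \<in> ?N u" using G by (auto simp: open_nbhd_iff pair_graph_iff)
      have "h \<in> pverts G" if "h \<in> ?N u" using that by (simp add: open_nbhd_def)
      then show ?thesis using sym indep[of u] rest[of h] unfolding H_def by blast
    qed
    then show ?thesis by auto
  qed
  then have "card (SIGMA u:?S. ?N u - ?L) = card (SIGMA h:H. ?N h)" by (metis card_inverse)
  then have "(\<Sum>u \<in> ?S. card (?N u - ?L)) = (\<Sum>h \<in> H. card (?N h))"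
    using fin finN by (simp add: card_SigmaI)
  also have "\<dots> = (\<Sum>h \<in> H. 2)" using rest by (intro sum.cong) auto
  also have "\<dots> = (\<Sum>u \<in> ?S. 2)" using cH by simp
  also have "\<dots> < (\<Sum>u \<in> ?S. card (?N u - ?L))"
    using ge v ne fin(1) by (intro sum_strict_mono_ex1) (auto intro!: bexI[of _ v] simp: le_neq_implies_less)
  finally show False by simp
qed

text \<open>Induction on the number of vertices: undoing O1 or O2 keeps all three assumptions, and a
  graph where neither can be undone is a starting graph.\<close>

lemma subdivided_corona_in_family_G:
  assumes "unicycle_graph G" "arc_connected G" "subdivided_corona G"
  shows "G \<in> family_G"
  using assms
proof (induct "card (pverts G)" arbitrary: G rule: less_induct)
  case less
  note U = less(2) and c = less(3) and t = less(4)
  note G = unicycle_graph_pair_graph[OF U]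
  let ?L = "leaves G" and ?S = "support_vertices G" and ?N = "open_nbhd G"
  have SL: "?S \<inter> ?L = {}" and indep: "\<And>v. v \<in> ?S \<Longrightarrow> ?N v \<inter> ?S = {}"
    and rest: "\<And>v. v \<in> pverts G \<Longrightarrow> v \<notin> ?L \<Longrightarrow> v \<notin> ?S \<Longrightarrow> card (?N v) = 2 \<and> ?N v \<subseteq> ?S"
    using t by (auto simp: subdivided_corona_def vertex_degree_def)
  have finV: "finite (pverts G)" using G by (simp add: pair_graph_iff)
  have SV: "?S \<subseteq> pverts G" and LV: "?L \<subseteq> pverts G" by (rule support_vertices_subset leaves_subset)+
  have sym: "u \<in> ?N w \<longleftrightarrow> w \<in> ?N u" for u w using G by (auto simp: open_nbhd_iff pair_graph_iff)
  \<comment> \<open>If no support vertex has two leaves, each has exactly one; then either some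
    support vertex has fewer than two nonleaf neighbours, or none does.\<close>
  consider (O1) v a b where "v \<in> ?S" "a \<in> ?L" "b \<in> ?L" "a \<in> ?N v" "b \<in> ?N v" "a \<noteq> b"
    | (O2) v a where "v \<in> ?S" "?N v \<inter> ?L = {a}" "card (?N v - ?L) < 2"
    | (cycle) "\<And>v. v \<in> ?S \<Longrightarrow> \<exists>a. ?N v \<inter> ?L = {a}" "\<And>v. v \<in> ?S \<Longrightarrow> 2 \<le> card (?N v - ?L)"
  proof -
    have "\<exists>a. ?N v \<inter> ?L = {a}"
      if "v \<in> ?S" "\<And>a b. a \<in> ?N v \<inter> ?L \<Longrightarrow> b \<in> ?N v \<inter> ?L \<Longrightarrow> a = b" for v
    proof -
      obtain a where "a \<in> ?N v \<inter> ?L" using \<open>v \<in> ?S\<close> by (auto simp: support_vertices_def)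
      then show ?thesis using that(2) by blast
    qed
    then show thesis using O1 O2 cycle by (metis IntD1 IntD2 not_less)
  qed
  then show ?case
  proof cases
    case (O1 v a b)
    let ?G = "delete_vertex G a"
    have v: "v \<in> pverts G" "v \<noteq> a" using O1 SV SL by auto
    have Na: "?N a = {v}" and Nb: "?N b = {v}" using O1 leaf_nbhd[OF G] by blast+
    have G': "pair_graph ?G" by (rule pair_graph_delete_vertex[OF G])
    have va: "v \<in> pverts ?G" "a \<notin> pverts ?G" using v by (auto simp: delete_vertex_def)
    have eq: "op1 ?G v a = G" by (rule op1_delete_vertex[OF G _ Na]) (use O1 LV in blast)
    have U': "unicycle_graph ?G" using unicycle_graph_op1[OF G' va] U eq by simp
    have c': "arc_connected ?G" using arc_connected_op1D[OF G' va] c eq by simp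
    \<comment> \<open>The second leaf \<open>b\<close> keeps \<open>v\<close> a support vertex after
      \<open>a\<close> is deleted, so O1 may be applied there.\<close>
    have "open_nbhd ?G b = {v}"
      using Nb v O1 by (simp add: open_nbhd_delete_vertex)
    moreover have "b \<in> pverts ?G" using O1 LV by (auto simp: delete_vertex_def)
    moreover have "b \<in> open_nbhd ?G v" using O1 v by (simp add: open_nbhd_delete_vertex)
    ultimately have vS: "v \<in> support_vertices ?G"
      using va by (auto simp: support_vertices_def leaves_def vertex_degree_def)
    then have vL: "v \<notin> leaves ?G" using support_disjoint_leaves[OF U' c'] by blast
    have t': "subdivided_corona ?G" using subdivided_corona_op1[OF G' vS vL va(2)] t eq by simp
    have "card (pverts ?G) < card (pverts G)"
      using card_Diff1_less[OF finV, of a] O1 LV by (auto simp: delete_vertex_def)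
    then have "?G \<in> family_G" using less(1) U' c' t' by blast
    then have "op1 ?G v a \<in> family_G" using vS va(2) U eq by (intro family_G.O1) simp_all
    then show ?thesis using eq by simp
  next
    case (O2 v a)
    obtain h where h: "h \<in> ?N v" "h \<notin> ?L" using support_has_nonleaf_nbr[OF U c O2(1)] by blast
    have aL: "a \<in> ?L" "a \<in> ?N v" using O2 by blast+
    have "finite (?N v - ?L)" using finite_open_nbhd[OF G] by simp
    then have "?N v - ?L = {h}"
      using O2(3) h card_le_Suc0_iff_eq[of "?N v - ?L"] by auto
    then have Nv: "?N v = {a, h}" using O2(2) by blast
    have hS: "h \<notin> ?S" "h \<in> pverts G" using indep[OF O2(1)] h by (auto simp: open_nbhd_def)
    have vh: "v \<in> ?N h" using h sym by blast
    have Nh: "card (?N h) = 2" "?N h \<subseteq> ?S" using rest hS h by blast+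
    \<comment> \<open>The second neighbour \<open>w\<close> of the subdivision vertex
      \<open>h\<close> is the support vertex at which the path \<open>h\<close>, \<open>v\<close>,
      \<open>a\<close> was attached.\<close>
    obtain w where w: "?N h = {v, w}" "w \<noteq> v"
      using Nh(1) vh by (metis card_2_iff doubleton_eq_iff insertE singletonD)
    have wS: "w \<in> ?S" using Nh w by blast
    have Na: "?N a = {v}" using leaf_nbhd[OF G aL] .
    have ne: "a \<noteq> h" "a \<noteq> v" "v \<noteq> h" "w \<noteq> h" "w \<noteq> a" using aL h hS O2(1) wS SL by auto
    \<comment> \<open>Deleted in the order \<open>a\<close>, \<open>v\<close>, \<open>h\<close>,
      each vertex is pendent at its turn, so three uses of \<open>op1_delete_vertex\<close> recover
      \<open>G\<close>.\<close>
    let ?A = "delete_vertex G a" let ?B = "delete_vertex ?A v" let ?C = "delete_vertex ?B h"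
    have gA: "pair_graph ?A" by (rule pair_graph_delete_vertex[OF G])
    have gB: "pair_graph ?B" by (rule pair_graph_delete_vertex[OF gA])
    have gC: "pair_graph ?C" by (rule pair_graph_delete_vertex[OF gB])
    have NA: "open_nbhd ?A v = {h}" using Nv ne by (auto simp: open_nbhd_delete_vertex)
    have NB: "open_nbhd ?B h = {w}" using w ne by (auto simp: open_nbhd_delete_vertex)
    have verts: "v \<in> pverts ?A" "h \<in> pverts ?B" "a \<in> pverts G" "w \<in> pverts ?C"
      using O2(1) SV hS aL LV wS w ne by (auto simp: delete_vertex_def)
    have eq: "op2 ?C w h v a = G"
      unfolding op2_eq_op1 op1_delete_vertex[OF gB verts(2) NB] op1_delete_vertex[OF gA verts(1) NA]
      by (rule op1_delete_vertex[OF G verts(3) Na])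
    have d: "{h, v, a} \<inter> pverts ?C = {}" "distinct [h, v, a]"
      using ne by (auto simp: delete_vertex_def)
    have U': "unicycle_graph ?C" using unicycle_graph_op2[OF gC verts(4) d] U eq by simp
    have c': "arc_connected ?C" using arc_connected_op2D[OF gC verts(4) d] c eq by simp
    \<comment> \<open>A leaf \<open>u\<close> at \<open>w\<close> survives the deletions and shows
      that \<open>w\<close> is still a support vertex.\<close>
    obtain u where u: "u \<in> ?L" "u \<in> ?N w" using wS by (auto simp: support_vertices_def)
    have Nu: "?N u = {w}" using leaf_nbhd[OF G u] .
    have une: "u \<noteq> a" "u \<noteq> v" "u \<noteq> h" using Na Nu w u h O2(1) SL by auto
    have "open_nbhd ?C u = {w}" using Nu une ne w by (auto simp: open_nbhd_delete_vertex)
    moreover have "u \<in> pverts ?C" using u LV une by (auto simp: delete_vertex_def)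
    moreover have "u \<in> open_nbhd ?C w" using u une ne w by (auto simp: open_nbhd_delete_vertex)
    ultimately have wS': "w \<in> support_vertices ?C"
      using verts by (auto simp: support_vertices_def leaves_def vertex_degree_def)
    then have wL': "w \<notin> leaves ?C" using support_disjoint_leaves[OF U' c'] by blast
    have t': "subdivided_corona ?C" using subdivided_corona_op2[OF gC wS' wL' d] t eq by simp
    have "pverts ?C \<subset> pverts G" using verts(3) by (auto simp: delete_vertex_def)
    then have "card (pverts ?C) < card (pverts G)" by (rule psubset_card_mono[OF finV])
    then have "?C \<in> family_G" using less(1) U' c' t' by blast
    then have "op2 ?C w h v a \<in> family_G" using wS' d U eq by (intro family_G.O2) simp_all
    then show ?thesis using eq by simp
  next
    case cycle
    show ?thesis
      by (rule subdivided_corona_cycle[OF U c t cycle(1) card_nonleaf_nbrs_eq_2[OF G t cycle(2)]])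
  qed
qed

theorem theorem8:
  fixes G :: "'a pair_pre_digraph"
  assumes "unicycle_graph G"
    and "Digraph_Component.connected (with_proj G)"
  shows "real (global_offensive_alliance_number G) =
           (real (card (pverts G)) - real (card (leaves G)) + real (card (support_vertices G))) / 3
         \<longleftrightarrow> G \<in> family_G"
proof -
  have c: "arc_connected G"
    using connected_imp_arc_connected[OF unicycle_graph_pair_graph[OF assms(1)] assms(2)] .
  \<comment> \<open>Clearing the fraction and the subtraction gives an equation between natural
    numbers.\<close>
  have "real (global_offensive_alliance_number G) =
           (real (card (pverts G)) - real (card (leaves G)) + real (card (support_vertices G))) / 3
     \<longleftrightarrow> card (pverts G) + card (support_vertices G) =
           3 * global_offensive_alliance_number G + card (leaves G)"
    by (auto simp: field_simps)
  also have "\<dots> \<longleftrightarrow> G \<in> family_G"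
    unfolding global_offensive_alliance_number_eq_iff[OF assms(1) c]
    using subdivided_corona_in_family_G[OF assms(1) c] family_G_structure by blast
  finally show ?thesis .
qed

end
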